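(* Consider a sequence of finite populations, indexed by the sample size $n\to\infty$, each satisfying the null hypothesis $H_0:\ T_i(1)=T_i(0)$ for all $i$, Assumption 1 and Assumption 2, and suppose Condition 1 holds. Then, conditioning on all potential event times, $U$ is a consistent variance estimator for $L$: $$\frac{U}{\mathrm{Var}\{L\mid\boldsymbol{T}(1),\boldsymbol{T}(0)\}}\ \Big|\ \boldsymbol{T}(1),\boldsymbol{T}(0)\ \xrightarrow{\ \Pr\ }\ 1,$$ and the logrank statistic $\mathrm{LR}=U^{-1/2}L$ satisfies $\mathrm{LR}\mid\boldsymbol{T}(1),\boldsymbol{T}(0)\ \xrightarrow{d}\ \mathcal{N}(0,1)$.
   Context: For a population of $n$ units: unit $i$ has potential event times $T_i(1),T_i(0)\ge 0$ (treated as fixed constants), potential censoring times $C_i(1),C_i(0)\in[0,\infty]$, and treatment indicator $Z_i\in\{0,1\}$; bold letters denote $n$-vectors. Assumption 1: conditional on $\boldsymbol{T}(1),\boldsymbol{T}(0),\boldsymbol{C}(1),\boldsymbol{C}(0)$, the $Z_i$ are i.i.d. Bernoulli$(p_1)$, $p_1=1-p_0\in(0,1)$. Assumption 2: $(\boldsymbol{C}(1),\boldsymbol{C}(0))$ is independent of $(\boldsymbol{T}(1),\boldsymbol{T}(0))$ and the pairs $(C_i(1),C_i(0))$ are i.i.d. across $i$. Let $G_z(c)=\Pr(C_i(z)\ge c)$ and $\tilde G(t)=G_1(t)G_0(t)$. Realized: $T_i=Z_iT_i(1)+(1-Z_i)T_i(0)$, $C_i=Z_iC_i(1)+(1-Z_i)C_i(0)$,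 $W_i=\min\{T_i,C_i\}$, $\Delta_i=\mathbb{1}(T_i\le C_i)$. Let $t_1<\dots<t_K$ be the distinct values of $\{T_i(0)\}$, $d_k=\#\{i:T_i(0)=t_k\}$. For $1\le k\le K$: $N_{1k}=\sum_iZ_i\mathbb{1}(W_i\ge t_k)$, $N_{0k}=\sum_i(1-Z_i)\mathbb{1}(W_i\ge t_k)$, $N_k=N_{1k}+N_{0k}$, $D_{1k}=\sum_iZ_i\Delta_i\mathbb{1}(W_i=t_k)$, $D_k=\sum_i\Delta_i\mathbb{1}(W_i=t_k)$, $M_k=D_kN_{1k}/N_k$, $V_k=D_k(N_k-D_k)N_{1k}N_{0k}/\{N_k^2(N_k-1)\}$ (convention $0/0:=0$); $L=\sum_k(D_{1k}-M_k)$, $U=\sum_kV_k$. Define $\tilde d=\max_{1\le k\le K}d_k$ and $\tilde g=n^{-1}\sum_{i=1}^n\tilde G(T_i(0))$. All quantities ($p_z$, $G_z$, $K$, $t_k$, $d_k$, $\tilde d$, $\tilde g$, ...) may depend on $n$. Condition 1: as $n\to\infty$, (i) for $z=0,1$, $p_z$ has a positive limit; (ii) $\min\{(\tilde g/\tilde d)(n/\log n)^{1/2},\ \tilde g n/\tilde d^3\}\to\infty$. *)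

theory Defs
  imports "HOL-Probability.Probability"
begin

text \<open>One finite population of size n.  Event times are fixed real constants
 T1 i, T0 i (i < n).  An outcome of the randomisation/censoring mechanism is
 a function om with om i = (Z_i, (C_i(1), C_i(0))), censoring times in [0,\<infinity>]
 represented as ennreal.\<close>

type_synonym outcome = "nat \<Rightarrow> bool \<times> (ennreal \<times> ennreal)"

definition Zi :: "outcome \<Rightarrow> nat \<Rightarrow> bool" where
  "Zi om i = fst (om i)"

definition Ti :: "(nat \<Rightarrow> real) \<Rightarrow> (nat \<Rightarrow> real) \<Rightarrow> outcome \<Rightarrow> nat \<Rightarrow> real" where
  "Ti T1 T0 om i = (if Zi om i then T1 i else T0 i)"

definition Ci :: "outcome \<Rightarrow> nat \<Rightarrow> ennreal" where
  "Ci om i = (if Zi om i then fst (snd (om i)) else snd (snd (om i)))"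

definition Wi :: "(nat \<Rightarrow> real) \<Rightarrow> (nat \<Rightarrow> real) \<Rightarrow> outcome \<Rightarrow> nat \<Rightarrow> ennreal" where
  "Wi T1 T0 om i = min (ennreal (Ti T1 T0 om i)) (Ci om i)"

definition Deltai :: "(nat \<Rightarrow> real) \<Rightarrow> (nat \<Rightarrow> real) \<Rightarrow> outcome \<Rightarrow> nat \<Rightarrow> bool" where
  "Deltai T1 T0 om i = (ennreal (Ti T1 T0 om i) \<le> Ci om i)"

definition tvals :: "nat \<Rightarrow> (nat \<Rightarrow> real) \<Rightarrow> real set" where
  "tvals n T0 = T0 ` {..<n}"

definition dcount :: "nat \<Rightarrow> (nat \<Rightarrow> real) \<Rightarrow> real \<Rightarrow> nat" where
  "dcount n T0 t = card {i. i < n \<and> T0 i = t}"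

definition N1 :: "nat \<Rightarrow> (nat \<Rightarrow> real) \<Rightarrow> (nat \<Rightarrow> real) \<Rightarrow> outcome \<Rightarrow> real \<Rightarrow> real" where
  "N1 n T1 T0 om t = real (card {i. i < n \<and> Zi om i \<and> Wi T1 T0 om i \<ge> ennreal t})"

definition N0 :: "nat \<Rightarrow> (nat \<Rightarrow> real) \<Rightarrow> (nat \<Rightarrow> real) \<Rightarrow> outcome \<Rightarrow> real \<Rightarrow> real" where
  "N0 n T1 T0 om t = real (card {i. i < n \<and> \<not> Zi om i \<and> Wi T1 T0 om i \<ge> ennreal t})"

definition Ntot :: "nat \<Rightarrow> (nat \<Rightarrow> real) \<Rightarrow> (nat \<Rightarrow> real) \<Rightarrow> outcome \<Rightarrow> real \<Rightarrow> real" where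
  "Ntot n T1 T0 om t = N1 n T1 T0 om t + N0 n T1 T0 om t"

definition D1 :: "nat \<Rightarrow> (nat \<Rightarrow> real) \<Rightarrow> (nat \<Rightarrow> real) \<Rightarrow> outcome \<Rightarrow> real \<Rightarrow> real" where
  "D1 n T1 T0 om t = real (card {i. i < n \<and> Zi om i \<and> Deltai T1 T0 om i \<and> Wi T1 T0 om i = ennreal t})"

definition Dtot :: "nat \<Rightarrow> (nat \<Rightarrow> real) \<Rightarrow> (nat \<Rightarrow> real) \<Rightarrow> outcome \<Rightarrow> real \<Rightarrow> real" where
  "Dtot n T1 T0 om t = real (card {i. i < n \<and> Deltai T1 T0 om i \<and> Wi T1 T0 om i = ennreal t})"

text \<open>M_k and V_k; Isabelle's convention x / 0 = 0 realises the paper's 0/0 := 0.\<close>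
definition Mk :: "nat \<Rightarrow> (nat \<Rightarrow> real) \<Rightarrow> (nat \<Rightarrow> real) \<Rightarrow> outcome \<Rightarrow> real \<Rightarrow> real" where
  "Mk n T1 T0 om t = Dtot n T1 T0 om t * N1 n T1 T0 om t / Ntot n T1 T0 om t"

definition Vk :: "nat \<Rightarrow> (nat \<Rightarrow> real) \<Rightarrow> (nat \<Rightarrow> real) \<Rightarrow> outcome \<Rightarrow> real \<Rightarrow> real" where
  "Vk n T1 T0 om t =
     Dtot n T1 T0 om t * (Ntot n T1 T0 om t - Dtot n T1 T0 om t) * N1 n T1 T0 om t * N0 n T1 T0 om t
     / ((Ntot n T1 T0 om t)\<^sup>2 * (Ntot n T1 T0 om t - 1))"

definition Lstat :: "nat \<Rightarrow> (nat \<Rightarrow> real) \<Rightarrow> (nat \<Rightarrow> real) \<Rightarrow> outcome \<Rightarrow> real" where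
  "Lstat n T1 T0 om = (\<Sum>t\<in>tvals n T0. D1 n T1 T0 om t - Mk n T1 T0 om t)"

definition Ustat :: "nat \<Rightarrow> (nat \<Rightarrow> real) \<Rightarrow> (nat \<Rightarrow> real) \<Rightarrow> outcome \<Rightarrow> real" where
  "Ustat n T1 T0 om = (\<Sum>t\<in>tvals n T0. Vk n T1 T0 om t)"

definition LRstat :: "nat \<Rightarrow> (nat \<Rightarrow> real) \<Rightarrow> (nat \<Rightarrow> real) \<Rightarrow> outcome \<Rightarrow> real" where
  "LRstat n T1 T0 om = Lstat n T1 T0 om / sqrt (Ustat n T1 T0 om)"

text \<open>Law of the randomisation/censoring mechanism for a population of size n:
 units i.i.d., Z_i ~ Bernoulli(p1) independent of (C_i(1), C_i(0)) ~ Q.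
 Since the potential event times are fixed constants, this measure is the
 conditional law given T(1), T(0).\<close>
definition pop_measure :: "nat \<Rightarrow> real \<Rightarrow> (ennreal \<times> ennreal) measure \<Rightarrow> outcome measure" where
  "pop_measure n p1 Q = PiM {..<n} (\<lambda>_. measure_pmf (bernoulli_pmf p1) \<Otimes>\<^sub>M Q)"

definition G1 :: "(ennreal \<times> ennreal) measure \<Rightarrow> real \<Rightarrow> real" where
  "G1 Q c = measure Q {x \<in> space Q. fst x \<ge> ennreal c}"

definition G0 :: "(ennreal \<times> ennreal) measure \<Rightarrow> real \<Rightarrow> real" where
  "G0 Q c = measure Q {x \<in> space Q. snd x \<ge> ennreal c}"

definition Gtilde :: "(ennreal \<times> ennreal) measure \<Rightarrow> real \<Rightarrow> real" where
  "Gtilde Q c = G1 Q c * G0 Q c"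

definition dtilde :: "nat \<Rightarrow> (nat \<Rightarrow> real) \<Rightarrow> real" where
  "dtilde n T0 = real (Max (dcount n T0 ` tvals n T0))"

definition gtilde :: "nat \<Rightarrow> (nat \<Rightarrow> real) \<Rightarrow> (ennreal \<times> ennreal) measure \<Rightarrow> real" where
  "gtilde n T0 Q = (\<Sum>i<n. Gtilde Q (T0 i)) / real n"

definition pvariance :: "'a measure \<Rightarrow> ('a \<Rightarrow> real) \<Rightarrow> real" where
  "pvariance M X = integral\<^sup>L M (\<lambda>x. (X x - integral\<^sup>L M X)\<^sup>2)"

end

theory Submission
  imports Defs "HOL-Real_Asymp.Real_Asymp"
begin

text \<open>
  Let \<open>B\<^sub>t\<close> be the set of units with event time at least \<open>t\<close>, let \<open>m\<^sub>t\<close> be its size and \<open>d\<^sub>t\<close> the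
  number of units with event time \<open>t\<close>. A unit uncensored at \<open>t\<close> is treated with a probability
  \<open>e\<^sub>t\<close> that does not depend on the unit, so its score at \<open>t\<close>, the difference between its treatment
  indicator and \<open>e\<^sub>t\<close> (and \<open>0\<close> if it is censored before \<open>t\<close>), is centered. With \<open>S\<^sub>t\<close> the sum of
  the scores over \<open>B\<^sub>t\<close>,
  \<open>D\<^sub>1\<^sub>t - M\<^sub>t = (\<Sum>i\<in>B\<^sub>t. c\<^sub>t\<^sub>i * score\<^sub>t\<^sub>i) - (D\<^sub>t - (d\<^sub>t / m\<^sub>t) * N\<^sub>t) * S\<^sub>t / N\<^sub>t\<close>
  for the contrasts \<open>c\<^sub>t\<^sub>i = 1(T\<^sub>i = t) - d\<^sub>t / m\<^sub>t\<close>, which sum to zero over \<open>B\<^sub>t\<close>. Summed over \<open>t\<close>, the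
  first part is a sum of independent centered variables, one for each unit.

  The law of the data is invariant under permutations of \<open>B\<^sub>t\<close>, and everything that happened before
  \<open>t\<close> depends on the units in \<open>B\<^sub>t\<close> symmetrically. Hence a contrast at \<open>t\<close> is orthogonal to all
  earlier terms, and second moments add up over \<open>t\<close>. This bounds the second moment of the remainder
  by \<open>\<Sum>t. d\<^sub>t / m\<^sub>t \<le> harm n\<close>, while the variance of the linear part is of order at least
  \<open>n * gtilde\<close>. So the linear part decides the limit, and it obeys the central limit theorem because its
  summands are bounded by \<open>1 + harm n\<close>. The same symmetry gives
  \<open>E[D\<^sub>t * F] = (d\<^sub>t / m\<^sub>t) * E[N\<^sub>t * F]\<close> for symmetric \<open>F\<close>, which controls the first absolute moment
  of the error of \<open>U\<close>.
\<close>

section \<open>Convergence of characteristic functions\<close>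

lemma exp_minus_le_quadratic:
  fixes x :: real
  assumes "0 \<le> x"
  shows "\<bar>exp (- x) - (1 - x)\<bar> \<le> x\<^sup>2 / 2"
proof -
  have "1 - x \<le> exp (- x)"
    using exp_ge_add_one_self[of "- x"] by simp
  moreover have "exp (- x) \<le> 1 - x + x\<^sup>2 / 2"
  proof -
    let ?f = "\<lambda>x::real. 1 - x + x\<^sup>2 / 2 - exp (- x)"
    have "?f 0 \<le> ?f x"
    proof (rule DERIV_nonneg_imp_nondecreasing[OF assms])
      fix u :: real
      assume "0 \<le> u" "u \<le> x"
      show "\<exists>D. (?f has_real_derivative D) (at u) \<and> 0 \<le> D"
        by (rule exI[of _ "u - 1 + exp (- u)"])
          (use exp_ge_add_one_self[of "- u"] in \<open>auto intro!: derivative_eq_intros\<close>)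
    qed
    then show ?thesis by simp
  qed
  ultimately show ?thesis by simp
qed

lemma (in prob_space) char_sum_indep_bounded:
  fixes X :: "'i \<Rightarrow> 'a \<Rightarrow> real"
  assumes indep: "indep_vars (\<lambda>_. borel) X I"
    and mean: "\<And>i. i \<in> I \<Longrightarrow> expectation (X i) = 0"
    and bound: "\<And>i x. i \<in> I \<Longrightarrow> \<bar>X i x\<bar> \<le> b"
    and var: "(\<Sum>i\<in>I. expectation (\<lambda>x. (X i x)\<^sup>2)) = 1"
  shows "cmod (char (distr M borel (\<lambda>x. \<Sum>i\<in>I. X i x)) t - exp (- t\<^sup>2 / 2))
    \<le> \<bar>t\<bar> ^ 3 * b / 6 + t ^ 4 * b\<^sup>2 / 8"
proof -
  have rv: "random_variable borel (X i)" if "i \<in> I" for i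
    using indep that unfolding indep_vars_def2 by simp
  define s where "s i = expectation (\<lambda>x. (X i x)\<^sup>2)" for i
  have s_nonneg: "0 \<le> s i" for i
    unfolding s_def by simp
  have sq_le: "(X i x)\<^sup>2 \<le> b\<^sup>2" if "i \<in> I" for i x
    using power_mono[OF bound[OF that, of x], of 2] by simp
  have int1: "integrable M (X i)" if "i \<in> I" for i
    by (rule integrable_const_bound[where B=b]) (use rv bound that in auto)
  have int2: "integrable M (\<lambda>x. (X i x)\<^sup>2)" if "i \<in> I" for i
    by (rule integrable_const_bound[where B="b\<^sup>2"]) (use rv sq_le that in auto)
  have s_le: "s i \<le> b\<^sup>2" if "i \<in> I" for i
    unfolding s_def using integral_mono[OF int2[OF that], of "\<lambda>_. b\<^sup>2"] sq_le[OF that] prob_space by simp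
  have step: "cmod (char (distr M borel (X i)) t - exp (- t\<^sup>2 * s i / 2))
      \<le> (\<bar>t\<bar> ^ 3 * b / 6 + t ^ 4 * b\<^sup>2 / 8) * s i" (is "?lhs \<le> _") if i: "i \<in> I" for i
  proof -
    have "cmod (char (distr M borel (X i)) t - (1 - t\<^sup>2 * s i / 2))
        \<le> (t\<^sup>2 / 6) * expectation (\<lambda>x. min (6 * (X i x)\<^sup>2) (\<bar>t\<bar> * \<bar>X i x\<bar> ^ 3))"
      by (rule char_approx3'[OF rv[OF i]]) (use i mean int1 int2 in \<open>auto simp: s_def\<close>)
    also have "expectation (\<lambda>x. min (6 * (X i x)\<^sup>2) (\<bar>t\<bar> * \<bar>X i x\<bar> ^ 3))
        \<le> expectation (\<lambda>x. \<bar>t\<bar> * b * (X i x)\<^sup>2)"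
    proof (rule integral_mono)
      have [measurable]: "random_variable borel (X i)"
        by (rule rv[OF i])
      show "integrable M (\<lambda>x. min (6 * (X i x)\<^sup>2) (\<bar>t\<bar> * \<bar>X i x\<bar> ^ 3))"
        by (rule Bochner_Integration.integrable_bound[of _ "\<lambda>x. 6 * (X i x)\<^sup>2"])
          (use int2[OF i] in \<open>auto simp: abs_le_iff min_def\<close>)
      show "integrable M (\<lambda>x. \<bar>t\<bar> * b * (X i x)\<^sup>2)"
        using int2[OF i] by simp
      fix x
      have "\<bar>X i x\<bar> ^ 3 = \<bar>X i x\<bar> * (X i x)\<^sup>2"
        by (simp add: power3_eq_cube power2_eq_square abs_mult[symmetric] mult.assoc)
      also have "\<dots> \<le> b * (X i x)\<^sup>2"
        by (intro mult_right_mono bound i) auto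
      finally have "\<bar>t\<bar> * \<bar>X i x\<bar> ^ 3 \<le> \<bar>t\<bar> * (b * (X i x)\<^sup>2)"
        by (rule mult_left_mono) simp
      then show "min (6 * (X i x)\<^sup>2) (\<bar>t\<bar> * \<bar>X i x\<bar> ^ 3) \<le> \<bar>t\<bar> * b * (X i x)\<^sup>2"
        by (simp add: mult.assoc min.coboundedI2)
    qed
    finally have 1: "cmod (char (distr M borel (X i)) t - (1 - t\<^sup>2 * s i / 2))
        \<le> t\<^sup>2 / 6 * (\<bar>t\<bar> * b * s i)"
      by (simp add: mult_left_mono s_def)
    have "\<bar>exp (- (t\<^sup>2 * s i / 2)) - (1 - t\<^sup>2 * s i / 2)\<bar> \<le> (t\<^sup>2 * s i / 2)\<^sup>2 / 2"
      by (rule exp_minus_le_quadratic) (use s_nonneg[of i] in auto)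
    also have "\<dots> = t ^ 4 / 8 * (s i * s i)"
      by (simp add: power2_eq_square power4_eq_xxxx)
    also have "\<dots> \<le> t ^ 4 / 8 * (b\<^sup>2 * s i)"
      by (intro mult_left_mono mult_right_mono s_le i s_nonneg) auto
    finally have 2: "\<bar>(1 - t\<^sup>2 * s i / 2) - exp (- t\<^sup>2 * s i / 2)\<bar> \<le> t ^ 4 / 8 * (b\<^sup>2 * s i)"
      by (simp add: abs_minus_commute)
    have "?lhs \<le> cmod (char (distr M borel (X i)) t - (1 - t\<^sup>2 * s i / 2))
        + cmod (complex_of_real (1 - t\<^sup>2 * s i / 2) - complex_of_real (exp (- t\<^sup>2 * s i / 2)))"
      by (rule norm_diff_triangle_le[OF order_refl order_refl])
    also have "cmod (complex_of_real (1 - t\<^sup>2 * s i / 2) - complex_of_real (exp (- t\<^sup>2 * s i / 2)))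
        = \<bar>(1 - t\<^sup>2 * s i / 2) - exp (- t\<^sup>2 * s i / 2)\<bar>"
      by (simp only: of_real_diff[symmetric] norm_of_real)
    finally show ?thesis
      using 1 2 by (simp add: algebra_simps power3_eq_cube power2_eq_square)
  qed
  have fin: "finite I"
    using var by (rule_tac ccontr) simp
  have "exp (- t\<^sup>2 / 2) = (\<Prod>i\<in>I. exp (- t\<^sup>2 * s i / 2))"
  proof -
    have "(\<Sum>i\<in>I. - t\<^sup>2 * s i / 2) = - t\<^sup>2 / 2 * (\<Sum>i\<in>I. s i)"
      by (simp add: sum_distrib_left sum_distrib_right sum_negf sum_divide_distrib)
    then show ?thesis
      using var fin by (simp add: exp_sum[symmetric] s_def)
  qed
  then have "cmod (char (distr M borel (\<lambda>x. \<Sum>i\<in>I. X i x)) t - exp (- t\<^sup>2 / 2))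
      = cmod ((\<Prod>i\<in>I. char (distr M borel (X i)) t) - (\<Prod>i\<in>I. complex_of_real (exp (- t\<^sup>2 * s i / 2))))"
    using char_distr_sum[OF indep] by simp
  also have "\<dots> \<le> (\<Sum>i\<in>I. cmod (char (distr M borel (X i)) t - exp (- t\<^sup>2 * s i / 2)))"
  proof (rule norm_prod_diff)
    fix i assume "i \<in> I"
    interpret D: real_distribution "distr M borel (X i)"
      using rv[OF \<open>i \<in> I\<close>] by (rule real_distribution_distr)
    show "cmod (char (distr M borel (X i)) t) \<le> 1"
      by (rule D.cmod_char_le_1)
    show "cmod (complex_of_real (exp (- t\<^sup>2 * s i / 2))) \<le> 1"
      using s_nonneg[of i] by simp
  qed
  also have "\<dots> \<le> (\<Sum>i\<in>I. (\<bar>t\<bar> ^ 3 * b / 6 + t ^ 4 * b\<^sup>2 / 8) * s i)"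
    by (rule sum_mono) (rule step)
  also have "\<dots> = \<bar>t\<bar> ^ 3 * b / 6 + t ^ 4 * b\<^sup>2 / 8"
    using var by (simp add: sum_distrib_left[symmetric] s_def)
  finally show ?thesis .
qed

lemma (in prob_space) char_distr_diff_le:
  assumes [measurable]: "random_variable borel X" "random_variable borel Y" and "0 < \<epsilon>"
  shows "cmod (char (distr M borel X) t - char (distr M borel Y) t)
    \<le> \<bar>t\<bar> * \<epsilon> + 2 * prob {x \<in> space M. \<epsilon> < \<bar>X x - Y x\<bar>}"
proof -
  let ?A = "{x \<in> space M. \<epsilon> < \<bar>X x - Y x\<bar>}"
  have int: "integrable M (\<lambda>x. iexp (t * X x))" if [measurable]: "random_variable borel X" for X
    by (rule integrable_const_bound[where B=1]) auto
  have "char (distr M borel X) t - char (distr M borel Y) t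
      = expectation (\<lambda>x. iexp (t * X x) - iexp (t * Y x))"
    unfolding char_def by (simp add: integral_distr int del: of_real_mult)
  also have "cmod \<dots> \<le> expectation (\<lambda>x. cmod (iexp (t * X x) - iexp (t * Y x)))"
    by (rule integral_norm_bound)
  also have "\<dots> \<le> expectation (\<lambda>x. \<bar>t\<bar> * \<epsilon> + 2 * indicator ?A x)"
  proof (rule integral_mono)
    show "integrable M (\<lambda>x. cmod (iexp (t * X x) - iexp (t * Y x)))"
      by (intro integrable_norm Bochner_Integration.integrable_diff int) auto
    show "integrable M (\<lambda>x. \<bar>t\<bar> * \<epsilon> + 2 * indicator ?A x)"
      by (auto simp: emeasure_eq_measure)
    fix x assume x: "x \<in> space M"
    show "cmod (iexp (t * X x) - iexp (t * Y x)) \<le> \<bar>t\<bar> * \<epsilon> + 2 * indicator ?A x"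
    proof (cases "x \<in> ?A")
      case True
      have "cmod (iexp (t * X x) - iexp (t * Y x)) \<le> 1 + 1"
        by (rule order_trans[OF norm_triangle_ineq4]) simp
      then show ?thesis
        using True \<open>0 < \<epsilon>\<close> by (simp add: add_increasing)
    next
      case False
      have "iexp (t * X x) - iexp (t * Y x) = iexp (t * Y x) * (iexp (t * X x - t * Y x) - 1)"
        by (simp add: algebra_simps exp_add[symmetric])
      then have "cmod (iexp (t * X x) - iexp (t * Y x)) = cmod (iexp (t * X x - t * Y x) - 1)"
        by (simp add: norm_mult)
      also have "\<dots> \<le> \<bar>t * X x - t * Y x\<bar>"
        using iexp_approx1[of "t * X x - t * Y x" 0] by simp
      also have "\<dots> = \<bar>t\<bar> * \<bar>X x - Y x\<bar>"
        by (simp add: abs_mult[symmetric] algebra_simps)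
      also have "\<dots> \<le> \<bar>t\<bar> * \<epsilon>"
        using False x by (intro mult_left_mono) auto
      finally show ?thesis
        using False by simp
    qed
  qed
  also have "\<dots> = \<bar>t\<bar> * \<epsilon> + 2 * prob ?A"
    using prob_space by (simp add: emeasure_eq_measure)
  finally show ?thesis .
qed

lemma (in prob_space) prob_abs_ge_le_second_moment:
  assumes [measurable]: "random_variable borel X" and "integrable M (\<lambda>x. (X x)\<^sup>2)" and "0 < c"
  shows "prob {x \<in> space M. c \<le> \<bar>X x\<bar>} \<le> expectation (\<lambda>x. (X x)\<^sup>2) / c\<^sup>2"
proof -
  have "prob {x \<in> space M. c \<le> \<bar>X x\<bar>} = prob {x \<in> space M. c\<^sup>2 \<le> (X x)\<^sup>2}"
    using \<open>0 < c\<close> by (intro arg_cong[where f=prob]) (auto simp: abs_le_square_iff[symmetric])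
  also have "\<dots> \<le> expectation (\<lambda>x. (X x)\<^sup>2) / c\<^sup>2"
    by (rule integral_Markov_inequality_measure[where A="{}"]) (use assms in auto)
  finally show ?thesis .
qed

lemma second_moment_perturbation:
  fixes X R :: "'a \<Rightarrow> real"
  assumes "integrable M (\<lambda>x. (X x)\<^sup>2)" "integrable M (\<lambda>x. (R x)\<^sup>2)" "0 < a"
    and [measurable]: "X \<in> borel_measurable M" "R \<in> borel_measurable M"
  shows "\<bar>(\<integral>x. (X x + R x)\<^sup>2 \<partial>M) - (\<integral>x. (X x)\<^sup>2 \<partial>M)\<bar>
    \<le> a * (\<integral>x. (X x)\<^sup>2 \<partial>M) + (1 + 1 / a) * (\<integral>x. (R x)\<^sup>2 \<partial>M)"
proof -
  have amgm: "2 * \<bar>X x * R x\<bar> \<le> a * (X x)\<^sup>2 + (R x)\<^sup>2 / a" for x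
  proof -
    have "0 \<le> (a * \<bar>X x\<bar> - \<bar>R x\<bar>)\<^sup>2 / a"
      using \<open>0 < a\<close> by simp
    also have "\<dots> = a * (X x)\<^sup>2 - 2 * \<bar>X x * R x\<bar> + (R x)\<^sup>2 / a"
      using \<open>0 < a\<close> by (simp add: power2_diff power_mult_distrib abs_mult field_simps) (simp add: power2_eq_square)
    finally show ?thesis by simp
  qed
  have int: "integrable M (\<lambda>x. a * (X x)\<^sup>2 + (1 + 1 / a) * (R x)\<^sup>2)"
    using assms by auto
  have pw: "\<bar>(X x + R x)\<^sup>2 - (X x)\<^sup>2\<bar> \<le> a * (X x)\<^sup>2 + (1 + 1 / a) * (R x)\<^sup>2" for x
  proof -
    have "\<bar>(X x + R x)\<^sup>2 - (X x)\<^sup>2\<bar> = \<bar>2 * (X x * R x) + (R x)\<^sup>2\<bar>"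
      by (simp add: power2_sum)
    also have "\<dots> \<le> 2 * \<bar>X x * R x\<bar> + (R x)\<^sup>2"
      by (rule order_trans[OF abs_triangle_ineq]) (simp add: abs_mult)
    finally show ?thesis
      using amgm[of x] by (simp add: distrib_right)
  qed
  have int2: "integrable M (\<lambda>x. (X x + R x)\<^sup>2 - (X x)\<^sup>2)"
    by (rule Bochner_Integration.integrable_bound[OF int]) (use pw in \<open>auto intro!: AE_I2 order_trans[OF pw abs_ge_self]\<close>)
  have int3: "integrable M (\<lambda>x. (X x + R x)\<^sup>2)"
    using Bochner_Integration.integrable_add[OF int2 assms(1)] by simp
  have "\<bar>(\<integral>x. (X x + R x)\<^sup>2 \<partial>M) - (\<integral>x. (X x)\<^sup>2 \<partial>M)\<bar> = \<bar>\<integral>x. (X x + R x)\<^sup>2 - (X x)\<^sup>2 \<partial>M\<bar>"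
    using int3 assms(1) by simp
  also have "\<dots> \<le> (\<integral>x. \<bar>(X x + R x)\<^sup>2 - (X x)\<^sup>2\<bar> \<partial>M)"
    by (rule integral_abs_bound)
  also have "\<dots> \<le> (\<integral>x. a * (X x)\<^sup>2 + (1 + 1 / a) * (R x)\<^sup>2 \<partial>M)"
    using int int2 pw by (intro integral_mono) auto
  also have "\<dots> = a * (\<integral>x. (X x)\<^sup>2 \<partial>M) + (1 + 1 / a) * (\<integral>x. (R x)\<^sup>2 \<partial>M)"
    using assms by simp
  finally show ?thesis .
qed

lemma inverse_sqrt_near_1:
  fixes u :: real
  assumes "\<bar>u - 1\<bar> \<le> \<eta>" "\<eta> \<le> 1 / 2"
  shows "\<bar>1 / sqrt u - 1\<bar> \<le> 2 * \<eta>"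
proof -
  have u: "1 / 2 \<le> u"
    using assms by linarith
  have "(1 / 2)\<^sup>2 \<le> u"
    using u by (simp add: power2_eq_square)
  then have r: "1 / 2 \<le> sqrt u"
    by (rule real_le_rsqrt)
  have "\<bar>1 + sqrt u\<bar> = 1 + sqrt u"
    using r by linarith
  have "\<bar>1 - sqrt u\<bar> * 1 \<le> \<bar>1 - sqrt u\<bar> * (1 + sqrt u)"
    using u by (intro mult_left_mono) auto
  also have "\<dots> = \<bar>(1 - sqrt u) * (1 + sqrt u)\<bar>"
    using \<open>\<bar>1 + sqrt u\<bar> = 1 + sqrt u\<close> by (simp only: abs_mult)
  also have "\<dots> = \<bar>u - 1\<bar>"
    using u by (simp add: algebra_simps abs_minus_commute)
  finally have "\<bar>1 - sqrt u\<bar> \<le> \<eta>"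
    using assms by simp
  have "\<bar>1 / sqrt u - 1\<bar> = \<bar>1 - sqrt u\<bar> / sqrt u"
  proof -
    have "1 / sqrt u - 1 = (1 - sqrt u) / sqrt u"
      using u by (simp add: field_simps)
    then show ?thesis
      using u by (simp add: abs_divide)
  qed
  also have "\<dots> \<le> \<eta> / (1 / 2)"
    using r \<open>\<bar>1 - sqrt u\<bar> \<le> \<eta>\<close> by (intro frac_le) auto
  finally show ?thesis by simp
qed

lemma studentized_convergence:
  fixes M :: "nat \<Rightarrow> 'a measure" and L X U :: "nat \<Rightarrow> 'a \<Rightarrow> real" and v :: "nat \<Rightarrow> real"
  defines "s \<equiv> \<lambda>n. \<integral>x. (X n x)\<^sup>2 \<partial>M n" and "\<tau> \<equiv> \<lambda>n. \<integral>x. (L n x)\<^sup>2 \<partial>M n"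
  assumes M: "\<And>n. prob_space (M n)"
    and meas: "\<And>n. L n \<in> borel_measurable (M n)" "\<And>n. X n \<in> borel_measurable (M n)"
      "\<And>n. U n \<in> borel_measurable (M n)"
    and int: "\<And>n. integrable (M n) (\<lambda>x. (L n x)\<^sup>2)" "\<And>n. integrable (M n) (\<lambda>x. (X n x)\<^sup>2)"
      "\<And>n. integrable (M n) (\<lambda>x. (L n x - X n x)\<^sup>2)" "\<And>n. integrable (M n) (U n)"
    and v: "eventually (\<lambda>n. 0 < v n) sequentially"
    and diff: "(\<lambda>n. (\<integral>x. (L n x - X n x)\<^sup>2 \<partial>M n) / v n) \<longlonglongrightarrow> 0"
    and X_var: "(\<lambda>n. s n / v n) \<longlonglongrightarrow> 1"
    and U_lim: "(\<lambda>n. (\<integral>x. \<bar>U n x - v n\<bar> \<partial>M n) / v n) \<longlonglongrightarrow> 0"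
    and clt: "\<And>t. (\<lambda>n. char (distr (M n) borel (\<lambda>x. X n x / sqrt (s n))) t) \<longlonglongrightarrow> exp (- t\<^sup>2 / 2)"
  shows "\<And>e. 0 < e \<Longrightarrow> (\<lambda>n. measure (M n) {x \<in> space (M n). e < \<bar>U n x / \<tau> n - 1\<bar>}) \<longlonglongrightarrow> 0"
    and "weak_conv_m (\<lambda>n. distr (M n) borel (\<lambda>x. L n x / sqrt (U n x))) std_normal_distribution"
proof -
  note [measurable] = meas
  define \<delta> where "\<delta> n = (\<integral>x. (L n x - X n x)\<^sup>2 \<partial>M n) / v n" for n
  define \<kappa> where "\<kappa> n = (\<integral>x. \<bar>U n x - v n\<bar> \<partial>M n) / v n" for n
  \<comment> \<open>A positive null sequence \<open>a\<close> with \<open>r / a \<le> sqrt r\<close>, so that weights and thresholds tend to \<open>0\<close>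
    more slowly than \<open>r\<close>.\<close>
  define pad where "pad = (\<lambda>r n. sqrt (r n) + inverse (real (Suc n)))" for r :: "nat \<Rightarrow> real"
  have pad_pos: "0 < pad r n" if "0 \<le> r n" for r n
    using that by (simp add: pad_def add_nonneg_pos)
  have pad_lim: "pad r \<longlonglongrightarrow> 0" if "r \<longlonglongrightarrow> 0" for r
    unfolding pad_def using tendsto_add[OF tendsto_real_sqrt[OF that] LIMSEQ_inverse_real_of_nat] by simp
  have div_pad: "r n / pad r n \<le> sqrt (r n)" if "0 \<le> r n" for r n
  proof -
    have "r n = sqrt (r n) * sqrt (r n)"
      using that by simp
    also have "\<dots> \<le> sqrt (r n) * pad r n"
      using that by (intro mult_left_mono) (auto simp: pad_def)
    finally show ?thesis
      using pad_pos[of r n] that by (simp add: pos_divide_le_eq)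
  qed
  have \<delta>0: "\<delta> \<longlonglongrightarrow> 0" and \<kappa>0: "\<kappa> \<longlonglongrightarrow> 0"
    using diff U_lim by (simp_all add: \<delta>_def[abs_def] \<kappa>_def[abs_def])
  have \<delta>_nn: "0 \<le> \<delta> n" and \<kappa>_nn: "0 \<le> \<kappa> n" if "0 < v n" for n
    using that by (auto simp: \<delta>_def \<kappa>_def)
  have \<tau>_lim: "(\<lambda>n. \<tau> n / v n) \<longlonglongrightarrow> 1"
  proof (rule Lim_transform[OF X_var])
    have "(\<lambda>n. pad \<delta> n * (s n / v n) + (\<delta> n + sqrt (\<delta> n))) \<longlonglongrightarrow> 0 * 1 + (0 + sqrt 0)"
      by (intro tendsto_intros pad_lim \<delta>0 X_var)
    then have lim: "(\<lambda>n. pad \<delta> n * (s n / v n) + (\<delta> n + sqrt (\<delta> n))) \<longlonglongrightarrow> 0"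
      by simp
    show "(\<lambda>n. \<tau> n / v n - s n / v n) \<longlonglongrightarrow> 0"
    proof (rule Lim_null_comparison[OF _ lim])
      show "\<forall>\<^sub>F n in sequentially. norm (\<tau> n / v n - s n / v n) \<le> pad \<delta> n * (s n / v n) + (\<delta> n + sqrt (\<delta> n))"
        using v
      proof eventually_elim
        case (elim n)
        have a: "0 < pad \<delta> n"
          using pad_pos[of \<delta> n] \<delta>_nn[OF elim] by simp
        have "\<bar>\<tau> n - s n\<bar> \<le> pad \<delta> n * s n + (1 + 1 / pad \<delta> n) * (\<integral>x. (L n x - X n x)\<^sup>2 \<partial>M n)"
          using second_moment_perturbation[OF int(2)[of n] int(3)[of n] a] by (simp add: \<tau>_def s_def)
        then have "\<bar>\<tau> n - s n\<bar> / v n \<le> (pad \<delta> n * s n + (1 + 1 / pad \<delta> n) * (\<integral>x. (L n x - X n x)\<^sup>2 \<partial>M n)) / v n"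
          using elim by (intro divide_right_mono) auto
        also have "\<dots> = pad \<delta> n * (s n / v n) + (\<delta> n + \<delta> n / pad \<delta> n)"
          by (simp add: \<delta>_def add_divide_distrib distrib_right)
        finally show ?case
          using div_pad[of \<delta> n] \<delta>_nn[OF elim] elim
          by (simp add: diff_divide_distrib[symmetric])
      qed
    qed
  qed
  have \<tau>_pos: "eventually (\<lambda>n. 0 < \<tau> n) sequentially"
    using v order_tendstoD(1)[OF \<tau>_lim zero_less_one]
    by eventually_elim (auto simp: zero_less_divide_iff)
  show "(\<lambda>n. measure (M n) {x \<in> space (M n). e < \<bar>U n x / \<tau> n - 1\<bar>}) \<longlonglongrightarrow> 0" if e: "0 < e" for e
  proof (rule tendsto_sandwich[OF _ _ tendsto_const])
    let ?b = "\<lambda>n. (\<kappa> n + \<bar>1 - \<tau> n / v n\<bar>) / (\<tau> n / v n) / e"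
    have "?b \<longlonglongrightarrow> (0 + \<bar>1 - 1\<bar>) / 1 / e"
      by (intro tendsto_intros \<kappa>0 \<tau>_lim) (use e in auto)
    then show "?b \<longlonglongrightarrow> 0" by simp
    show "\<forall>\<^sub>F n in sequentially. measure (M n) {x \<in> space (M n). e < \<bar>U n x / \<tau> n - 1\<bar>} \<le> ?b n"
      using v \<tau>_pos
    proof eventually_elim
      case (elim n)
      interpret prob_space "M n" by (rule M)
      have iU: "integrable (M n) (\<lambda>x. \<bar>U n x - v n\<bar>)" "integrable (M n) (\<lambda>x. \<bar>U n x / \<tau> n - 1\<bar>)"
        using int(4)[of n] by auto
      have "measure (M n) {x \<in> space (M n). e < \<bar>U n x / \<tau> n - 1\<bar>}
          \<le> measure (M n) {x \<in> space (M n). e \<le> \<bar>U n x / \<tau> n - 1\<bar>}"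
        by (rule finite_measure_mono) auto
      also have "\<dots> \<le> expectation (\<lambda>x. \<bar>U n x / \<tau> n - 1\<bar>) / e"
        by (rule integral_Markov_inequality_measure[where A="{}"]) (use e iU in auto)
      also have "expectation (\<lambda>x. \<bar>U n x / \<tau> n - 1\<bar>) \<le> expectation (\<lambda>x. (\<bar>U n x - v n\<bar> + \<bar>v n - \<tau> n\<bar>) / \<tau> n)"
      proof (rule integral_mono[OF iU(2)])
        show "integrable (M n) (\<lambda>x. (\<bar>U n x - v n\<bar> + \<bar>v n - \<tau> n\<bar>) / \<tau> n)"
          using iU by auto
        fix x
        have "\<bar>U n x / \<tau> n - 1\<bar> = \<bar>U n x - \<tau> n\<bar> / \<tau> n"
          using elim by (simp add: field_simps abs_divide)
        also have "\<dots> \<le> (\<bar>U n x - v n\<bar> + \<bar>v n - \<tau> n\<bar>) / \<tau> n"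
          using elim by (intro divide_right_mono) auto
        finally show "\<bar>U n x / \<tau> n - 1\<bar> \<le> (\<bar>U n x - v n\<bar> + \<bar>v n - \<tau> n\<bar>) / \<tau> n" .
      qed
      also have "expectation (\<lambda>x. (\<bar>U n x - v n\<bar> + \<bar>v n - \<tau> n\<bar>) / \<tau> n)
          = (expectation (\<lambda>x. \<bar>U n x - v n\<bar>) + \<bar>v n - \<tau> n\<bar>) / \<tau> n"
        using iU prob_space by simp
      also have "\<dots> = (\<kappa> n + \<bar>1 - \<tau> n / v n\<bar>) / (\<tau> n / v n)"
      proof -
        have "\<bar>1 - \<tau> n / v n\<bar> = \<bar>v n - \<tau> n\<bar> / v n"
          using elim by (simp add: field_simps abs_divide)
        then show ?thesis
          using elim by (simp add: \<kappa>_def add_divide_distrib[symmetric])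
      qed
      finally show ?case
        using e by (simp add: divide_right_mono)
    qed
  qed auto
  have close: "(\<lambda>n. measure (M n) {x \<in> space (M n). 3 * \<epsilon> < \<bar>L n x / sqrt (U n x) - X n x / sqrt (s n)\<bar>}) \<longlonglongrightarrow> 0"
    if \<epsilon>: "0 < \<epsilon>" for \<epsilon>
  proof (rule tendsto_sandwich[OF _ _ tendsto_const])
    let ?b = "\<lambda>n. sqrt (\<kappa> n) + \<tau> n / v n * (2 * pad \<kappa> n / \<epsilon>)\<^sup>2 + \<delta> n / \<epsilon>\<^sup>2 + (sqrt (s n / v n) - 1)\<^sup>2 / \<epsilon>\<^sup>2"
    have "?b \<longlonglongrightarrow> sqrt 0 + 1 * (2 * 0 / \<epsilon>)\<^sup>2 + 0 / \<epsilon>\<^sup>2 + (sqrt 1 - 1)\<^sup>2 / \<epsilon>\<^sup>2"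
      by (intro tendsto_intros \<kappa>0 \<delta>0 \<tau>_lim X_var pad_lim) (use \<epsilon> in auto)
    then show "?b \<longlonglongrightarrow> 0" by simp
    have "eventually (\<lambda>n. pad \<kappa> n < 1 / 2) sequentially" "eventually (\<lambda>n. 0 < s n / v n) sequentially"
      using order_tendstoD(2)[OF pad_lim[OF \<kappa>0], of "1 / 2"] order_tendstoD(1)[OF X_var, of 0] by auto
    with v show "\<forall>\<^sub>F n in sequentially. measure (M n)
        {x \<in> space (M n). 3 * \<epsilon> < \<bar>L n x / sqrt (U n x) - X n x / sqrt (s n)\<bar>} \<le> ?b n"
    proof eventually_elim
      case (elim n)
      interpret prob_space "M n" by (rule M)
      define \<eta> where "\<eta> = pad \<kappa> n"
      have \<eta>: "0 < \<eta>" "\<eta> \<le> 1 / 2"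
        using pad_pos[of \<kappa> n] \<kappa>_nn elim by (auto simp: \<eta>_def)
      have sn: "0 < s n"
        using elim by (simp add: zero_less_divide_iff)
      let ?A1 = "{x \<in> space (M n). \<eta> \<le> \<bar>U n x / v n - 1\<bar>}"
      let ?A2 = "{x \<in> space (M n). \<epsilon> / (2 * \<eta>) \<le> \<bar>L n x / sqrt (v n)\<bar>}"
      let ?A3 = "{x \<in> space (M n). \<epsilon> \<le> \<bar>(L n x - X n x) / sqrt (v n)\<bar>}"
      let ?A4 = "{x \<in> space (M n). \<epsilon> \<le> \<bar>X n x * (1 / sqrt (v n) - 1 / sqrt (s n))\<bar>}"
      have sub: "{x \<in> space (M n). 3 * \<epsilon> < \<bar>L n x / sqrt (U n x) - X n x / sqrt (s n)\<bar>} \<subseteq> ?A1 \<union> ?A2 \<union> ?A3 \<union> ?A4"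
      proof (rule subsetI, rule ccontr)
        fix x
        assume x: "x \<in> {x \<in> space (M n). 3 * \<epsilon> < \<bar>L n x / sqrt (U n x) - X n x / sqrt (s n)\<bar>}"
          and "x \<notin> ?A1 \<union> ?A2 \<union> ?A3 \<union> ?A4"
        then have b: "\<bar>U n x / v n - 1\<bar> \<le> \<eta>" "\<bar>L n x / sqrt (v n)\<bar> \<le> \<epsilon> / (2 * \<eta>)"
            "\<bar>(L n x - X n x) / sqrt (v n)\<bar> \<le> \<epsilon>" "\<bar>X n x * (1 / sqrt (v n) - 1 / sqrt (s n))\<bar> \<le> \<epsilon>"
          by auto
        have r: "\<bar>1 / sqrt (U n x / v n) - 1\<bar> \<le> 2 * \<eta>"
          by (rule inverse_sqrt_near_1[OF b(1) \<eta>(2)])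
        have "\<bar>L n x / sqrt (v n) * (1 / sqrt (U n x / v n) - 1)\<bar> \<le> \<epsilon> / (2 * \<eta>) * (2 * \<eta>)"
          unfolding abs_mult by (rule mult_mono[OF b(2) r]) (use \<eta> \<epsilon> in auto)
        then have p1: "\<bar>L n x / sqrt (v n) * (1 / sqrt (U n x / v n) - 1)\<bar> \<le> \<epsilon>"
          using \<eta> by simp
        have "L n x / sqrt (U n x) - X n x / sqrt (s n)
            = L n x / sqrt (v n) * (1 / sqrt (U n x / v n) - 1) + (L n x - X n x) / sqrt (v n)
              + X n x * (1 / sqrt (v n) - 1 / sqrt (s n))"
          using elim(1) by (simp add: real_sqrt_divide algebra_simps diff_divide_distrib)
        then have "\<bar>L n x / sqrt (U n x) - X n x / sqrt (s n)\<bar> \<le> 3 * \<epsilon>"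
          using p1 b(3,4) by (simp only: abs_le_iff) linarith
        then show False
          using x by simp
      qed
      have A1: "prob ?A1 \<le> sqrt (\<kappa> n)"
      proof -
        have "prob ?A1 \<le> expectation (\<lambda>x. \<bar>U n x / v n - 1\<bar>) / \<eta>"
          by (rule integral_Markov_inequality_measure[where A="{}"]) (use \<eta> int(4)[of n] in auto)
        also have "expectation (\<lambda>x. \<bar>U n x / v n - 1\<bar>) = expectation (\<lambda>x. \<bar>U n x - v n\<bar> / v n)"
          using elim by (intro Bochner_Integration.integral_cong) (auto simp: field_simps abs_divide)
        also have "expectation (\<lambda>x. \<bar>U n x - v n\<bar> / v n) / \<eta> = \<kappa> n / pad \<kappa> n"
          by (simp add: \<kappa>_def \<eta>_def)
        finally show ?thesis
          using div_pad[of \<kappa> n] \<kappa>_nn[OF elim(1)] by simp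
      qed
      have A2: "prob ?A2 \<le> \<tau> n / v n * (2 * pad \<kappa> n / \<epsilon>)\<^sup>2"
      proof -
        have "prob ?A2 \<le> expectation (\<lambda>x. (L n x / sqrt (v n))\<^sup>2) / (\<epsilon> / (2 * \<eta>))\<^sup>2"
          by (rule prob_abs_ge_le_second_moment) (use \<eta> \<epsilon> int(1)[of n] in \<open>auto simp: power_divide\<close>)
        also have "\<dots> = \<tau> n / v n * (2 * pad \<kappa> n / \<epsilon>)\<^sup>2"
          using elim(1) by (simp add: power_divide \<tau>_def \<eta>_def)
        finally show ?thesis .
      qed
      have A3: "prob ?A3 \<le> \<delta> n / \<epsilon>\<^sup>2"
      proof -
        have "prob ?A3 \<le> expectation (\<lambda>x. ((L n x - X n x) / sqrt (v n))\<^sup>2) / \<epsilon>\<^sup>2"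
          by (rule prob_abs_ge_le_second_moment) (use \<epsilon> int(3)[of n] in \<open>auto simp: power_divide\<close>)
        also have "\<dots> = \<delta> n / \<epsilon>\<^sup>2"
          using elim(1) by (simp add: power_divide \<delta>_def)
        finally show ?thesis .
      qed
      have A4: "prob ?A4 \<le> (sqrt (s n / v n) - 1)\<^sup>2 / \<epsilon>\<^sup>2"
      proof -
        have "prob ?A4 \<le> expectation (\<lambda>x. (X n x * (1 / sqrt (v n) - 1 / sqrt (s n)))\<^sup>2) / \<epsilon>\<^sup>2"
          by (rule prob_abs_ge_le_second_moment) (use \<epsilon> int(2)[of n] in \<open>auto simp: power_mult_distrib\<close>)
        also have "\<dots> = (sqrt (s n))\<^sup>2 * (1 / sqrt (v n) - 1 / sqrt (s n))\<^sup>2 / \<epsilon>\<^sup>2"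
          using sn by (simp add: power_mult_distrib s_def)
        also have "(sqrt (s n))\<^sup>2 * (1 / sqrt (v n) - 1 / sqrt (s n))\<^sup>2 = (sqrt (s n / v n) - 1)\<^sup>2"
          unfolding power_mult_distrib[symmetric] using sn by (simp add: right_diff_distrib real_sqrt_divide)
        finally show ?thesis .
      qed
      have "measure (M n) {x \<in> space (M n). 3 * \<epsilon> < \<bar>L n x / sqrt (U n x) - X n x / sqrt (s n)\<bar>}
          \<le> prob (?A1 \<union> ?A2 \<union> ?A3 \<union> ?A4)"
        by (rule finite_measure_mono[OF sub]) measurable
      also have "\<dots> \<le> prob (?A1 \<union> ?A2 \<union> ?A3) + prob ?A4"
        by (rule measure_Un_le) measurable
      also have "prob (?A1 \<union> ?A2 \<union> ?A3) \<le> prob (?A1 \<union> ?A2) + prob ?A3"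
        by (rule measure_Un_le) measurable
      also have "prob (?A1 \<union> ?A2) \<le> prob ?A1 + prob ?A2"
        by (rule measure_Un_le) measurable
      finally show ?case
        using A1 A2 A3 A4 by linarith
    qed
  qed auto
  show "weak_conv_m (\<lambda>n. distr (M n) borel (\<lambda>x. L n x / sqrt (U n x))) std_normal_distribution"
  proof (rule levy_continuity)
    fix n
    interpret prob_space "M n" by (rule M)
    show "real_distribution (distr (M n) borel (\<lambda>x. L n x / sqrt (U n x)))"
      by (rule real_distribution_distr) measurable
  next
    show "real_distribution std_normal_distribution"
      by (rule real_dist_normal_dist)
  next
    fix t
    let ?\<phi> = "\<lambda>n. char (distr (M n) borel (\<lambda>x. L n x / sqrt (U n x))) t"
    let ?\<psi> = "\<lambda>n. char (distr (M n) borel (\<lambda>x. X n x / sqrt (s n))) t"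
    have "(\<lambda>n. ?\<phi> n - ?\<psi> n) \<longlonglongrightarrow> 0"
    proof (rule tendstoI)
      fix e :: real
      assume "0 < e"
      define \<epsilon> where "\<epsilon> = e / (2 * (3 * (\<bar>t\<bar> + 1)))"
      have \<epsilon>: "0 < \<epsilon>"
        using \<open>0 < e\<close> by (simp add: \<epsilon>_def)
      have "\<bar>t\<bar> * (3 * \<epsilon>) \<le> (\<bar>t\<bar> + 1) * (3 * \<epsilon>)"
        using \<epsilon> by (intro mult_right_mono) auto
      also have "\<dots> = e / 2"
        by (simp add: \<epsilon>_def field_simps)
      finally have te: "\<bar>t\<bar> * (3 * \<epsilon>) \<le> e / 2" .
      have "\<forall>\<^sub>F n in sequentially.
          measure (M n) {x \<in> space (M n). 3 * \<epsilon> < \<bar>L n x / sqrt (U n x) - X n x / sqrt (s n)\<bar>} < e / 4"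
        using order_tendstoD(2)[OF close[OF \<epsilon>], of "e / 4"] \<open>0 < e\<close> by simp
      then show "\<forall>\<^sub>F n in sequentially. dist (?\<phi> n - ?\<psi> n) 0 < e"
      proof eventually_elim
        case (elim n)
        interpret prob_space "M n" by (rule M)
        have "cmod (?\<phi> n - ?\<psi> n) \<le> \<bar>t\<bar> * (3 * \<epsilon>)
            + 2 * prob {x \<in> space (M n). 3 * \<epsilon> < \<bar>L n x / sqrt (U n x) - X n x / sqrt (s n)\<bar>}"
          by (rule char_distr_diff_le) (use \<epsilon> in auto)
        then show ?case
          using te elim by simp
      qed
    qed
    then show "?\<phi> \<longlonglongrightarrow> char std_normal_distribution t"
      using Lim_transform[OF clt] by (simp add: char_std_normal_distribution)
  qed
qed

section \<open>The law of a single unit\<close>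

definition at_risk :: "real \<Rightarrow> bool \<times> ennreal \<times> ennreal \<Rightarrow> real" where
  "at_risk t w = of_bool (ennreal t \<le> (if fst w then fst (snd w) else snd (snd w)))"

definition treated :: "bool \<times> ennreal \<times> ennreal \<Rightarrow> real" where
  "treated w = of_bool (fst w)"

lemma at_risk_nonneg: "0 \<le> at_risk t w"
  and at_risk_le_1: "at_risk t w \<le> 1"
  and at_risk_idem: "at_risk t w * at_risk t w = at_risk t w"
  and at_risk_Ints: "at_risk t w \<in> \<int>"
  and at_risk_cases: "at_risk t w = 0 \<or> at_risk t w = 1"
  by (auto simp: at_risk_def)

lemma abs_inverse_Ints_le_1: "x \<in> \<int> \<Longrightarrow> \<bar>inverse x\<bar> \<le> (1::real)"
proof (elim Ints_cases)
  fix k :: int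
  assume "x = real_of_int k"
  show "\<bar>inverse x\<bar> \<le> 1"
  proof (cases "k = 0")
    case False
    then have "1 \<le> \<bar>x\<bar>"
      using \<open>x = real_of_int k\<close> by linarith
    then show ?thesis
      by (simp add: inverse_le_1_iff)
  qed (simp add: \<open>x = real_of_int k\<close>)
qed

locale logrank_population =
  fixes n :: nat and T1 T :: "nat \<Rightarrow> real" and p :: real and Q :: "(ennreal \<times> ennreal) measure"
  assumes null_hypothesis: "i < n \<Longrightarrow> T1 i = T i"
    and T_nonneg: "i < n \<Longrightarrow> 0 \<le> T i"
    and p_pos: "0 < p" and p_less_1: "p < 1"
    and prob_space_Q: "prob_space Q"
    and sets_Q: "sets Q = sets borel"
begin

definition unit_law :: "(bool \<times> ennreal \<times> ennreal) measure" where
  "unit_law = measure_pmf (bernoulli_pmf p) \<Otimes>\<^sub>M Q"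

definition P :: "outcome measure" where
  "P = pop_measure n p Q"

lemma P_eq_PiM: "P = PiM {..<n} (\<lambda>_. unit_law)"
  by (simp add: P_def pop_measure_def unit_law_def)

sublocale Q: prob_space Q
  by (rule prob_space_Q)

sublocale BQ: pair_prob_space "measure_pmf (bernoulli_pmf p)" Q ..

sublocale unit_law: prob_space unit_law
  unfolding unit_law_def by (rule BQ.prob_space_axioms)

sublocale PS: product_prob_space "\<lambda>_::nat. unit_law" "{..<n}"
  by standard

sublocale P: prob_space P
  unfolding P_eq_PiM by (rule PS.prob_space_axioms)

lemma sets_unit_law [measurable_cong]: "sets unit_law = sets (count_space UNIV \<Otimes>\<^sub>M (borel \<Otimes>\<^sub>M borel))"
  unfolding unit_law_def
  by (rule sets_pair_measure_cong) (simp_all only: sets_measure_pmf sets_count_space sets_Q borel_prod Pow_UNIV)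

lemma sets_P [measurable_cong]: "sets P = sets (PiM {..<n} (\<lambda>_. unit_law))"
  by (simp add: P_eq_PiM)

lemma at_risk_measurable [measurable]: "at_risk t \<in> borel_measurable unit_law"
  unfolding at_risk_def by measurable

lemma treated_measurable [measurable]: "treated \<in> borel_measurable unit_law"
  unfolding treated_def by measurable

lemma integral_unit_law:
  fixes f :: "bool \<times> ennreal \<times> ennreal \<Rightarrow> real"
  assumes [measurable]: "f \<in> borel_measurable unit_law" and "\<And>w. \<bar>f w\<bar> \<le> b"
  shows "integral\<^sup>L unit_law f = p * (\<integral>c. f (True, c) \<partial>Q) + (1 - p) * (\<integral>c. f (False, c) \<partial>Q)"
proof -
  have "integrable unit_law f"
    by (rule unit_law.integrable_const_bound[where B=b]) (use assms in auto)
  then have "integral\<^sup>L unit_law f = (\<integral>a. (\<integral>c. f (a, c) \<partial>Q) \<partial>measure_pmf (bernoulli_pmf p))"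
    unfolding unit_law_def by (rule BQ.integral_fst'[symmetric])
  also have "\<dots> = p * (\<integral>c. f (True, c) \<partial>Q) + (1 - p) * (\<integral>c. f (False, c) \<partial>Q)"
    by (subst integral_bernoulli_pmf) (use p_pos p_less_1 in auto)
  finally show ?thesis .
qed

lemma space_Q: "space Q = UNIV"
  using sets_eq_imp_space_eq[OF sets_Q] by simp

lemma integral_at_risk_mult:
  "(\<integral>w. at_risk t w * g (fst w) \<partial>unit_law) = p * G1 Q t * g True + (1 - p) * G0 Q t * g False"
proof -
  have Q1: "{x. ennreal t \<le> fst x} \<in> sets Q" and Q0: "{x. ennreal t \<le> snd x} \<in> sets Q"
    unfolding sets_Q by (intro borel_closed closed_Collect_le continuous_intros)+
  have "\<bar>at_risk t w * g (fst w)\<bar> \<le> \<bar>g True\<bar> + \<bar>g False\<bar>" for w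
    by (cases "fst w") (auto simp: at_risk_def)
  then have "(\<integral>w. at_risk t w * g (fst w) \<partial>unit_law)
      = p * (\<integral>c. at_risk t (True, c) * g True \<partial>Q) + (1 - p) * (\<integral>c. at_risk t (False, c) * g False \<partial>Q)"
    by (subst integral_unit_law) (auto simp: measurable_compose[OF measurable_fst])
  also have "(\<integral>c. at_risk t (True, c) * g True \<partial>Q) = (\<integral>c. indicator {x. ennreal t \<le> fst x} c * g True \<partial>Q)"
    by (rule arg_cong[where f="integral\<^sup>L Q"]) (auto simp: at_risk_def fun_eq_iff)
  also have "\<dots> = G1 Q t * g True"
    using Q1 by (simp add: G1_def space_Q)
  also have "(\<integral>c. at_risk t (False, c) * g False \<partial>Q) = (\<integral>c. indicator {x. ennreal t \<le> snd x} c * g False \<partial>Q)"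
    by (rule arg_cong[where f="integral\<^sup>L Q"]) (auto simp: at_risk_def fun_eq_iff)
  also have "\<dots> = G0 Q t * g False"
    using Q0 by (simp add: G0_def space_Q)
  finally show ?thesis
    by simp
qed

definition risk_prob :: "real \<Rightarrow> real" where
  "risk_prob t = p * G1 Q t + (1 - p) * G0 Q t"

definition treat_prob :: "real \<Rightarrow> real" where
  "treat_prob t = p * G1 Q t / risk_prob t"

definition score :: "real \<Rightarrow> bool \<times> ennreal \<times> ennreal \<Rightarrow> real" where
  "score t w = at_risk t w * (treated w - treat_prob t)"

definition score_var :: "real \<Rightarrow> real" where
  "score_var t = risk_prob t * (treat_prob t * (1 - treat_prob t))"

lemma G_nonneg: "0 \<le> G1 Q t" "0 \<le> G0 Q t"
  by (simp_all add: G1_def G0_def)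

lemma G_le_1: "G1 Q t \<le> 1" "G0 Q t \<le> 1"
  by (simp_all add: G1_def G0_def)

lemma risk_prob_nonneg: "0 \<le> risk_prob t"
  using p_pos p_less_1 G_nonneg[of t] by (simp add: risk_prob_def)

lemma risk_prob_le_1: "risk_prob t \<le> 1"
proof -
  have "risk_prob t \<le> p * 1 + (1 - p) * 1"
    unfolding risk_prob_def using p_pos p_less_1 G_le_1[of t] by (intro add_mono mult_left_mono) auto
  then show ?thesis by simp
qed

lemma risk_prob_mult_treat_prob: "risk_prob t * treat_prob t = p * G1 Q t"
  using p_pos p_less_1 G_nonneg[of t]
  by (auto simp: treat_prob_def risk_prob_def add_nonneg_eq_0_iff)

lemma treat_prob_nonneg: "0 \<le> treat_prob t"
  using p_pos G_nonneg[of t] risk_prob_nonneg[of t] by (simp add: treat_prob_def)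

lemma treat_prob_le_1: "treat_prob t \<le> 1"
  unfolding treat_prob_def using risk_prob_nonneg[of t] p_less_1 G_nonneg[of t]
  by (intro divide_le_eq_1[THEN iffD2]) (auto simp: risk_prob_def)

lemma score_var_nonneg: "0 \<le> score_var t"
  using risk_prob_nonneg[of t] treat_prob_nonneg[of t] treat_prob_le_1[of t] by (simp add: score_var_def)

lemma treat_prob_variance_le: "treat_prob t * (1 - treat_prob t) \<le> 1"
  using mult_mono[of "treat_prob t" 1 "1 - treat_prob t" 1] treat_prob_nonneg[of t] treat_prob_le_1[of t]
  by simp

lemma score_var_le_1: "score_var t \<le> 1"
  unfolding score_var_def
  using mult_mono[OF risk_prob_le_1[of t] treat_prob_variance_le[of t]]
    treat_prob_nonneg[of t] treat_prob_le_1[of t] by simp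

lemma score_var_ge: "p * (1 - p) * Gtilde Q t \<le> score_var t"
proof (cases "risk_prob t = 0")
  case True
  then have "G1 Q t = 0"
    using risk_prob_mult_treat_prob[of t] p_pos by simp
  then show ?thesis
    using score_var_nonneg by (simp add: Gtilde_def)
next
  case False
  then have pos: "0 < risk_prob t"
    using risk_prob_nonneg[of t] by simp
  have *: "1 - treat_prob t = (1 - p) * G0 Q t / risk_prob t"
    using pos by (simp add: treat_prob_def risk_prob_def field_simps)
  have "score_var t = p * (1 - p) * Gtilde Q t / risk_prob t"
    unfolding score_var_def * using pos by (simp add: treat_prob_def Gtilde_def)
  moreover have "p * (1 - p) * Gtilde Q t \<le> p * (1 - p) * Gtilde Q t / risk_prob t"
    using divide_left_mono[OF risk_prob_le_1[of t], of "p * (1 - p) * Gtilde Q t"] pos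
      p_pos p_less_1 G_nonneg[of t] by (simp add: Gtilde_def)
  ultimately show ?thesis by simp
qed

lemma score_measurable [measurable]: "score t \<in> borel_measurable unit_law"
  unfolding score_def by measurable

lemma abs_score_le_at_risk: "\<bar>score t w\<bar> \<le> at_risk t w"
proof -
  have "\<bar>treated w - treat_prob t\<bar> \<le> 1"
    using treat_prob_nonneg[of t] treat_prob_le_1[of t] by (auto simp: treated_def)
  then show ?thesis
    unfolding score_def abs_mult using mult_left_mono[of _ 1 "at_risk t w"] at_risk_nonneg[of t w] by simp
qed

lemma abs_score_le_1: "\<bar>score t w\<bar> \<le> 1"
  using abs_score_le_at_risk[of t w] at_risk_le_1[of t w] by linarith

lemma score_sq_le_at_risk: "(score t w)\<^sup>2 \<le> at_risk t w"
proof -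
  have "(score t w)\<^sup>2 \<le> (at_risk t w)\<^sup>2"
    using power_mono[OF abs_score_le_at_risk[of t w], of 2] by simp
  then show ?thesis
    by (simp add: power2_eq_square at_risk_idem)
qed

lemma integral_at_risk: "(\<integral>w. at_risk t w \<partial>unit_law) = risk_prob t"
  using integral_at_risk_mult[of t "\<lambda>_. 1"] by (simp add: risk_prob_def)

lemma integral_score: "(\<integral>w. score t w \<partial>unit_law) = 0"
  using integral_at_risk_mult[of t "\<lambda>b. of_bool b - treat_prob t"] risk_prob_mult_treat_prob[of t]
  by (simp add: score_def treated_def risk_prob_def algebra_simps)

lemma integral_score_sq: "(\<integral>w. (score t w)\<^sup>2 \<partial>unit_law) = score_var t"
proof -
  have "(\<integral>w. (score t w)\<^sup>2 \<partial>unit_law) = (\<integral>w. at_risk t w * (of_bool (fst w) - treat_prob t)\<^sup>2 \<partial>unit_law)"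
    by (rule arg_cong[where f="integral\<^sup>L unit_law"])
      (simp add: fun_eq_iff score_def treated_def power_mult_distrib power2_eq_square[of "at_risk _ _"] at_risk_idem)
  also have "\<dots> = p * G1 Q t * (1 - treat_prob t)\<^sup>2 + (1 - p) * G0 Q t * (treat_prob t)\<^sup>2"
    using integral_at_risk_mult[of t "\<lambda>b. (of_bool b - treat_prob t)\<^sup>2"] by simp
  also have "\<dots> = p * G1 Q t * (1 - treat_prob t)\<^sup>2 + (risk_prob t - p * G1 Q t) * (treat_prob t)\<^sup>2"
    by (simp add: risk_prob_def)
  also have "\<dots> = score_var t"
    unfolding risk_prob_mult_treat_prob[symmetric] score_var_def by (simp add: power2_eq_square algebra_simps)
  finally show ?thesis .
qed

definition bdd_rv :: "(outcome \<Rightarrow> real) \<Rightarrow> bool" where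
  "bdd_rv X \<longleftrightarrow> X \<in> borel_measurable P \<and> (\<exists>b. \<forall>\<omega>. \<bar>X \<omega>\<bar> \<le> b)"

lemma bdd_rv_measurable [measurable_dest]: "bdd_rv X \<Longrightarrow> X \<in> borel_measurable P"
  by (simp add: bdd_rv_def)

lemma bdd_rv_integrable: "bdd_rv X \<Longrightarrow> integrable P X"
  unfolding bdd_rv_def by (auto intro!: P.integrable_const_bound AE_I2)

lemma bdd_rv_const [intro]: "bdd_rv (\<lambda>_. c)"
  unfolding bdd_rv_def by auto

lemma bdd_rv_add [intro]:
  assumes "bdd_rv X" "bdd_rv Y" shows "bdd_rv (\<lambda>\<omega>. X \<omega> + Y \<omega>)"
proof -
  obtain a b where "\<And>\<omega>. \<bar>X \<omega>\<bar> \<le> a" "\<And>\<omega>. \<bar>Y \<omega>\<bar> \<le> b"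
    using assms unfolding bdd_rv_def by auto
  then have "\<bar>X \<omega> + Y \<omega>\<bar> \<le> a + b" for \<omega>
    using abs_triangle_ineq[of "X \<omega>" "Y \<omega>"] by (meson add_mono order_trans)
  with assms show ?thesis
    unfolding bdd_rv_def by auto
qed

lemma bdd_rv_mult [intro]:
  assumes "bdd_rv X" "bdd_rv Y" shows "bdd_rv (\<lambda>\<omega>. X \<omega> * Y \<omega>)"
proof -
  obtain a b where "\<And>\<omega>. \<bar>X \<omega>\<bar> \<le> a" "\<And>\<omega>. \<bar>Y \<omega>\<bar> \<le> b"
    using assms unfolding bdd_rv_def by auto
  then have "\<bar>X \<omega> * Y \<omega>\<bar> \<le> a * b" for \<omega>
    unfolding abs_mult by (intro mult_mono') auto
  with assms show ?thesis
    unfolding bdd_rv_def by auto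
qed

lemma bdd_rv_uminus [intro]: "bdd_rv X \<Longrightarrow> bdd_rv (\<lambda>\<omega>. - X \<omega>)"
  using bdd_rv_mult[OF bdd_rv_const[of "-1"], of X] by simp

lemma bdd_rv_diff [intro]: "bdd_rv X \<Longrightarrow> bdd_rv Y \<Longrightarrow> bdd_rv (\<lambda>\<omega>. X \<omega> - Y \<omega>)"
  using bdd_rv_add[OF _ bdd_rv_uminus, of X Y] by simp

lemma bdd_rv_abs [intro]: "bdd_rv X \<Longrightarrow> bdd_rv (\<lambda>\<omega>. \<bar>X \<omega>\<bar>)"
  unfolding bdd_rv_def by auto

lemma bdd_rv_power2 [intro]: "bdd_rv X \<Longrightarrow> bdd_rv (\<lambda>\<omega>. (X \<omega>)\<^sup>2)"
  unfolding power2_eq_square by (rule bdd_rv_mult)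

lemma bdd_rv_sum [intro]: "(\<And>i. i \<in> I \<Longrightarrow> bdd_rv (X i)) \<Longrightarrow> bdd_rv (\<lambda>\<omega>. \<Sum>i\<in>I. X i \<omega>)"
  by (induction I rule: infinite_finite_induct) auto

lemma bdd_rv_inverse_Ints [intro]:
  "bdd_rv X \<Longrightarrow> (\<And>\<omega>. X \<omega> \<in> \<int>) \<Longrightarrow> bdd_rv (\<lambda>\<omega>. inverse (X \<omega>))"
  unfolding bdd_rv_def using abs_inverse_Ints_le_1 by (auto simp del: abs_inverse)

lemma bdd_rv_component:
  assumes "i < n" "f \<in> borel_measurable unit_law" "\<And>w. \<bar>f w\<bar> \<le> b"
  shows "bdd_rv (\<lambda>\<omega>. f (\<omega> i))"
  unfolding bdd_rv_def
proof
  show "(\<lambda>\<omega>. f (\<omega> i)) \<in> borel_measurable P"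
    using assms by (simp add: P_eq_PiM)
  show "\<exists>b. \<forall>\<omega>. \<bar>f (\<omega> i)\<bar> \<le> b"
    using assms(3) by blast
qed

lemma bdd_rv_at_risk [intro]: "i < n \<Longrightarrow> bdd_rv (\<lambda>\<omega>. at_risk t (\<omega> i))"
  by (rule bdd_rv_component[where b=1]) (auto simp: at_risk_def)

lemma bdd_rv_treated [intro]: "i < n \<Longrightarrow> bdd_rv (\<lambda>\<omega>. treated (\<omega> i))"
  by (rule bdd_rv_component[where b=1]) (auto simp: treated_def)

lemma bdd_rv_score [intro]: "i < n \<Longrightarrow> bdd_rv (\<lambda>\<omega>. score t (\<omega> i))"
  by (rule bdd_rv_component[where b=1]) (auto intro: abs_score_le_1)

lemma expectation_component:
  fixes f :: "bool \<times> ennreal \<times> ennreal \<Rightarrow> real"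
  assumes "i < n" "f \<in> borel_measurable unit_law"
  shows "P.expectation (\<lambda>\<omega>. f (\<omega> i)) = integral\<^sup>L unit_law f"
proof -
  have "integral\<^sup>L unit_law f = integral\<^sup>L (distr (PiM {..<n} (\<lambda>_. unit_law)) unit_law (\<lambda>\<omega>. \<omega> i)) f"
    using assms(1) by (subst PS.PiM_component) auto
  also have "\<dots> = P.expectation (\<lambda>\<omega>. f (\<omega> i))"
    unfolding P_eq_PiM using assms by (intro integral_distr) auto
  finally show ?thesis by simp
qed

lemma expectation_eq_0_if_component_integral_eq_0:
  assumes "i < n" "bdd_rv F" and "\<And>x. (\<integral>w. F (x(i := w)) \<partial>unit_law) = 0"
  shows "P.expectation F = 0"
proof -
  have I: "insert i ({..<n} - {i}) = {..<n}"
    using \<open>i < n\<close> by auto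
  have "P.expectation F = (\<integral>x. (\<integral>w. F (x(i := w)) \<partial>unit_law) \<partial>PiM ({..<n} - {i}) (\<lambda>_. unit_law))"
    using PS.product_integral_insert[of "{..<n} - {i}" i F] bdd_rv_integrable[OF assms(2)]
    unfolding I P_eq_PiM by simp
  then show ?thesis
    using assms(3) by simp
qed

lemma expectation_sum_centered_sq:
  fixes g :: "nat \<Rightarrow> bool \<times> ennreal \<times> ennreal \<Rightarrow> real"
  assumes C: "C \<subseteq> {..<n}"
    and g[measurable]: "\<And>i. i \<in> C \<Longrightarrow> g i \<in> borel_measurable unit_law"
    and bound: "\<And>i w. i \<in> C \<Longrightarrow> \<bar>g i w\<bar> \<le> b i"
    and mean: "\<And>i. i \<in> C \<Longrightarrow> integral\<^sup>L unit_law (g i) = 0"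
  shows "P.expectation (\<lambda>\<omega>. (\<Sum>i\<in>C. g i (\<omega> i))\<^sup>2) = (\<Sum>i\<in>C. \<integral>w. (g i w)\<^sup>2 \<partial>unit_law)"
proof -
  have fin: "finite C"
    using C finite_subset by auto
  have bdd: "bdd_rv (\<lambda>\<omega>. g i (\<omega> i))" if "i \<in> C" for i
    by (rule bdd_rv_component) (use C that g bound in auto)
  have "P.expectation (\<lambda>\<omega>. g i (\<omega> i) * g j (\<omega> j)) = (if j = i then \<integral>w. (g i w)\<^sup>2 \<partial>unit_law else 0)"
    if ij: "i \<in> C" "j \<in> C" for i j
  proof (cases "j = i")
    case True
    then show ?thesis
      using expectation_component[of i "\<lambda>w. (g i w)\<^sup>2"] C ij g by (auto simp: power2_eq_square)
  next
    case False
    then have "P.expectation (\<lambda>\<omega>. g i (\<omega> i) * g j (\<omega> j)) = 0"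
      by (intro expectation_eq_0_if_component_integral_eq_0[of i])
        (use C ij bdd mean in auto)
    with False show ?thesis by simp
  qed
  note cross = this
  have "P.expectation (\<lambda>\<omega>. (\<Sum>i\<in>C. g i (\<omega> i))\<^sup>2)
      = P.expectation (\<lambda>\<omega>. \<Sum>i\<in>C. \<Sum>j\<in>C. g i (\<omega> i) * g j (\<omega> j))"
    by (simp add: power2_eq_square sum_product)
  also have "\<dots> = (\<Sum>i\<in>C. \<Sum>j\<in>C. P.expectation (\<lambda>\<omega>. g i (\<omega> i) * g j (\<omega> j)))"
    using bdd by (subst Bochner_Integration.integral_sum; intro sum.cong refl bdd_rv_integrable bdd_rv_sum
      bdd_rv_mult Bochner_Integration.integral_sum) auto
  also have "\<dots> = (\<Sum>i\<in>C. \<integral>w. (g i w)\<^sup>2 \<partial>unit_law)"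
    by (simp add: cross fin cong: sum.cong)
  finally show ?thesis .
qed

section \<open>Exchangeability within risk sets\<close>

lemma expectation_permute:
  assumes "bdd_rv X" and \<pi>: "\<pi> permutes {..<n}"
  shows "P.expectation (\<lambda>\<omega>. X (\<omega> \<circ> \<pi>)) = P.expectation X"
proof -
  let ?f = "\<lambda>\<omega>. \<lambda>i\<in>{..<n}. \<omega> (\<pi> i)"
  have f: "?f \<in> measurable P P"
    unfolding P_eq_PiM using permutes_in_image[OF \<pi>] by (intro measurable_restrict) auto
  have eq: "?f \<omega> = \<omega> \<circ> \<pi>" if "\<omega> \<in> space P" for \<omega>
  proof
    fix i
    show "?f \<omega> i = (\<omega> \<circ> \<pi>) i"
    proof (cases "i < n")
      case False
      then have "\<pi> i = i" "\<omega> i = undefined"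
        using \<pi> that by (auto simp: permutes_def P_eq_PiM space_PiM PiE_def extensional_def)
      then show ?thesis using False by simp
    qed simp
  qed
  have "distr P P ?f = P"
    unfolding P_eq_PiM
    by (rule distr_PiM_reindex) (use \<pi> unit_law.prob_space_axioms in \<open>auto simp: permutes_inj_on permutes_in_image[OF \<pi>, simplified]\<close>)
  then have "P.expectation X = integral\<^sup>L (distr P P ?f) X"
    by simp
  also have "\<dots> = P.expectation (\<lambda>\<omega>. X (?f \<omega>))"
    using f assms(1) by (intro integral_distr) (auto simp: bdd_rv_def)
  also have "\<dots> = P.expectation (\<lambda>\<omega>. X (\<omega> \<circ> \<pi>))"
    by (rule Bochner_Integration.integral_cong) (auto simp: eq)
  finally show ?thesis by simp
qed

definition risk_set :: "real \<Rightarrow> nat set" where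
  "risk_set t = {i. i < n \<and> t \<le> T i}"

definition event_set :: "real \<Rightarrow> nat set" where
  "event_set t = {i. i < n \<and> T i = t}"

lemma finite_risk_set [simp]: "finite (risk_set t)"
  and finite_event_set [simp]: "finite (event_set t)"
  by (simp_all add: risk_set_def event_set_def)

lemma event_set_subset: "event_set t \<subseteq> risk_set t"
  by (auto simp: risk_set_def event_set_def)

lemma risk_set_subset: "risk_set t \<subseteq> {..<n}"
  by (auto simp: risk_set_def)

lemma risk_setD: "i \<in> risk_set t \<Longrightarrow> i < n"
  and event_setD: "i \<in> event_set t \<Longrightarrow> i < n"
  by (auto simp: risk_set_def event_set_def)

definition hazard :: "real \<Rightarrow> real" where
  "hazard t = real (card (event_set t)) / real (card (risk_set t))"

definition contrast :: "real \<Rightarrow> nat \<Rightarrow> real" where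
  "contrast t i = of_bool (T i = t) - hazard t"

lemma hazard_nonneg: "0 \<le> hazard t"
  by (simp add: hazard_def)

lemma hazard_le_1: "hazard t \<le> 1"
  unfolding hazard_def using card_mono[OF finite_risk_set event_set_subset, of t]
  by (auto simp: divide_le_eq_1 card_gt_0_iff)

lemma hazard_mult_card: "hazard t * real (card (risk_set t)) = real (card (event_set t))"
  using card_mono[OF finite_risk_set event_set_subset, of t] by (auto simp: hazard_def)

lemma sum_event_indicator: "(\<Sum>i\<in>risk_set t. of_bool (T i = t) * f i) = (\<Sum>i\<in>event_set t. f i)" for f :: "nat \<Rightarrow> real"
proof -
  have "event_set t = risk_set t \<inter> {i. T i = t}"
    by (auto simp: risk_set_def event_set_def)
  then show ?thesis
    by (simp add: sum.inter_restrict of_bool_def if_distrib[of "\<lambda>x. x * _"] cong: if_cong)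
qed

lemma sum_contrast_mult:
  "(\<Sum>i\<in>risk_set t. contrast t i * f i) = (\<Sum>i\<in>event_set t. f i) - hazard t * (\<Sum>i\<in>risk_set t. f i)"
  by (simp add: contrast_def left_diff_distrib sum_subtractf sum_event_indicator sum_distrib_left)

lemma sum_contrast: "(\<Sum>i\<in>risk_set t. contrast t i) = 0"
  using sum_contrast_mult[of t "\<lambda>_. 1"] hazard_mult_card[of t] by simp

lemma sum_contrast_sq: "(\<Sum>i\<in>risk_set t. (contrast t i)\<^sup>2) = real (card (event_set t)) * (1 - hazard t)"
proof -
  have "(\<Sum>i\<in>risk_set t. (contrast t i)\<^sup>2) = (\<Sum>i\<in>event_set t. contrast t i)"
    using sum_contrast_mult[of t "contrast t"] sum_contrast[of t] by (simp add: power2_eq_square)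
  also have "\<dots> = (\<Sum>i\<in>event_set t. 1 - hazard t)"
    by (rule sum.cong) (auto simp: event_set_def contrast_def)
  finally show ?thesis by simp
qed

definition exchangeable :: "real \<Rightarrow> (outcome \<Rightarrow> real) \<Rightarrow> bool" where
  "exchangeable t X \<longleftrightarrow> (\<forall>\<pi>. \<pi> permutes risk_set t \<longrightarrow> (\<forall>\<omega>. X (\<omega> \<circ> \<pi>) = X \<omega>))"

lemma exchangeable_const: "exchangeable t (\<lambda>_. c)"
  by (simp add: exchangeable_def)

lemma exchangeable_mult: "exchangeable t X \<Longrightarrow> exchangeable t Y \<Longrightarrow> exchangeable t (\<lambda>\<omega>. X \<omega> * Y \<omega>)"
  by (simp add: exchangeable_def)

lemma exchangeable_comp: "exchangeable t X \<Longrightarrow> exchangeable t (\<lambda>\<omega>. f (X \<omega>))"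
  by (simp add: exchangeable_def)

lemma exchangeable_sum:
  assumes "risk_set t \<subseteq> C" and c: "\<And>i. i \<in> risk_set t \<Longrightarrow> c i = c0"
  shows "exchangeable t (\<lambda>\<omega>. \<Sum>i\<in>C. c i * f (\<omega> i))"
  unfolding exchangeable_def
proof (intro allI impI)
  fix \<pi> and \<omega> :: outcome
  assume \<pi>: "\<pi> permutes risk_set t"
  have "c (\<pi> i) = c i" for i
    using c permutes_in_image[OF \<pi>, of i] permutes_not_in[OF \<pi>, of i] by (cases "i \<in> risk_set t") auto
  then show "(\<Sum>i\<in>C. c i * f ((\<omega> \<circ> \<pi>) i)) = (\<Sum>i\<in>C. c i * f (\<omega> i))"
    using sum.permute[OF permutes_subset[OF \<pi> assms(1)], of "\<lambda>i. c i * f (\<omega> i)"] by (simp add: comp_def)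
qed

lemma expectation_exchange:
  assumes X: "exchangeable t X" "bdd_rv X"
    and ij: "i \<in> risk_set t" "j \<in> risk_set t"
    and f: "\<And>i. i < n \<Longrightarrow> bdd_rv (\<lambda>\<omega>. f (\<omega> i))"
  shows "P.expectation (\<lambda>\<omega>. f (\<omega> i) * X \<omega>) = P.expectation (\<lambda>\<omega>. f (\<omega> j) * X \<omega>)"
proof -
  let ?\<pi> = "Transposition.transpose i j"
  have \<pi>: "?\<pi> permutes risk_set t"
    using ij by (rule permutes_swap_id)
  have "P.expectation (\<lambda>\<omega>. f ((\<omega> \<circ> ?\<pi>) i) * X (\<omega> \<circ> ?\<pi>)) = P.expectation (\<lambda>\<omega>. f (\<omega> i) * X \<omega>)"
    by (rule expectation_permute[of "\<lambda>\<omega>. f (\<omega> i) * X \<omega>"])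
      (use f risk_setD[OF ij(1)] X permutes_subset[OF \<pi> risk_set_subset] in auto)
  then show ?thesis
    using X(1) \<pi> by (simp add: exchangeable_def)
qed

lemma expectation_exchange_pair:
  assumes X: "exchangeable t X" "bdd_rv X"
    and ij: "i \<in> risk_set t" "j \<in> risk_set t" "k \<in> risk_set t" "l \<in> risk_set t" "i \<noteq> j" "k \<noteq> l"
    and f: "\<And>i. i < n \<Longrightarrow> bdd_rv (\<lambda>\<omega>. f (\<omega> i))"
  shows "P.expectation (\<lambda>\<omega>. f (\<omega> i) * f (\<omega> j) * X \<omega>) = P.expectation (\<lambda>\<omega>. f (\<omega> k) * f (\<omega> l) * X \<omega>)"
proof -
  let ?\<sigma> = "Transposition.transpose i k"
  let ?\<pi> = "Transposition.transpose (?\<sigma> j) l \<circ> ?\<sigma>"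
  have \<sigma>: "?\<sigma> permutes risk_set t"
    using ij(1,3) by (rule permutes_swap_id)
  then have \<pi>: "?\<pi> permutes risk_set t"
    by (intro permutes_compose permutes_swap_id) (use ij permutes_in_image[OF \<sigma>] in auto)
  have "?\<sigma> j \<noteq> k"
    using ij by (metis transpose_eq_iff)
  then have ik: "?\<pi> i = k" "?\<pi> j = l"
    using ij by auto
  have "P.expectation (\<lambda>\<omega>. f ((\<omega> \<circ> ?\<pi>) i) * f ((\<omega> \<circ> ?\<pi>) j) * X (\<omega> \<circ> ?\<pi>))
      = P.expectation (\<lambda>\<omega>. f (\<omega> i) * f (\<omega> j) * X \<omega>)"
    by (rule expectation_permute[of "\<lambda>\<omega>. f (\<omega> i) * f (\<omega> j) * X \<omega>"])
      (use f risk_setD[OF ij(1)] risk_setD[OF ij(2)] X permutes_subset[OF \<pi> risk_set_subset] in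
        \<open>auto intro!: bdd_rv_mult simp del: o_apply\<close>)
  then show ?thesis
    using X(1) \<pi> ik by (simp add: exchangeable_def)
qed

lemma expectation_weighted_sum:
  assumes X: "exchangeable t X" "bdd_rv X"
    and f: "\<And>i. i < n \<Longrightarrow> bdd_rv (\<lambda>\<omega>. f (\<omega> i))"
    and j: "j \<in> risk_set t"
  shows "P.expectation (\<lambda>\<omega>. (\<Sum>i\<in>risk_set t. c i * f (\<omega> i)) * X \<omega>)
    = (\<Sum>i\<in>risk_set t. c i) * P.expectation (\<lambda>\<omega>. f (\<omega> j) * X \<omega>)"
proof -
  have "P.expectation (\<lambda>\<omega>. (\<Sum>i\<in>risk_set t. c i * f (\<omega> i)) * X \<omega>)
      = P.expectation (\<lambda>\<omega>. \<Sum>i\<in>risk_set t. c i * (f (\<omega> i) * X \<omega>))"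
    by (simp add: sum_distrib_right mult.assoc)
  also have "\<dots> = (\<Sum>i\<in>risk_set t. P.expectation (\<lambda>\<omega>. c i * (f (\<omega> i) * X \<omega>)))"
    by (rule Bochner_Integration.integral_sum)
      (use X f risk_setD in \<open>auto intro!: bdd_rv_integrable bdd_rv_mult bdd_rv_const\<close>)
  also have "\<dots> = (\<Sum>i\<in>risk_set t. c i * P.expectation (\<lambda>\<omega>. f (\<omega> j) * X \<omega>))"
    by (rule sum.cong) (use expectation_exchange[OF X _ j f] in auto)
  finally show ?thesis
    by (simp add: sum_distrib_right)
qed

lemma expectation_contrast_eq_0:
  assumes X: "exchangeable t X" "bdd_rv X"
    and f: "\<And>i. i < n \<Longrightarrow> bdd_rv (\<lambda>\<omega>. f (\<omega> i))"
  shows "P.expectation (\<lambda>\<omega>. (\<Sum>i\<in>risk_set t. contrast t i * f (\<omega> i)) * X \<omega>) = 0"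
proof (cases "risk_set t = {}")
  case False
  then obtain j where "j \<in> risk_set t" by auto
  with expectation_weighted_sum[OF X f this, of "contrast t"] show ?thesis
    by (simp add: sum_contrast)
qed simp

lemma expectation_event_sum:
  assumes X: "exchangeable t X" "bdd_rv X"
    and f: "\<And>i. i < n \<Longrightarrow> bdd_rv (\<lambda>\<omega>. f (\<omega> i))"
  shows "P.expectation (\<lambda>\<omega>. (\<Sum>i\<in>event_set t. f (\<omega> i)) * X \<omega>)
    = hazard t * P.expectation (\<lambda>\<omega>. (\<Sum>i\<in>risk_set t. f (\<omega> i)) * X \<omega>)"
proof -
  have "P.expectation (\<lambda>\<omega>. (\<Sum>i\<in>risk_set t. contrast t i * f (\<omega> i)) * X \<omega>)
      = P.expectation (\<lambda>\<omega>. (\<Sum>i\<in>event_set t. f (\<omega> i)) * X \<omega>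
          - hazard t * ((\<Sum>i\<in>risk_set t. f (\<omega> i)) * X \<omega>))"
    unfolding sum_contrast_mult left_diff_distrib mult.assoc ..
  also have "\<dots> = P.expectation (\<lambda>\<omega>. (\<Sum>i\<in>event_set t. f (\<omega> i)) * X \<omega>)
      - hazard t * P.expectation (\<lambda>\<omega>. (\<Sum>i\<in>risk_set t. f (\<omega> i)) * X \<omega>)"
    by (subst Bochner_Integration.integral_diff)
      (use X f risk_setD event_setD in \<open>auto intro!: bdd_rv_integrable bdd_rv_mult bdd_rv_const bdd_rv_sum\<close>)
  finally show ?thesis
    using expectation_contrast_eq_0[OF X f] by simp
qed

lemma expectation_contrast_sq:
  assumes X: "bdd_rv X"
    and f: "\<And>i. i < n \<Longrightarrow> bdd_rv (\<lambda>\<omega>. f (\<omega> i))"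
    and \<alpha>: "\<And>i. i \<in> risk_set t \<Longrightarrow> P.expectation (\<lambda>\<omega>. f (\<omega> i) * f (\<omega> i) * X \<omega>) = \<alpha>"
    and \<beta>: "\<And>i j. i \<in> risk_set t \<Longrightarrow> j \<in> risk_set t \<Longrightarrow> i \<noteq> j
        \<Longrightarrow> P.expectation (\<lambda>\<omega>. f (\<omega> i) * f (\<omega> j) * X \<omega>) = \<beta>"
  shows "P.expectation (\<lambda>\<omega>. (\<Sum>i\<in>risk_set t. contrast t i * f (\<omega> i))\<^sup>2 * X \<omega>)
    = real (card (event_set t)) * (1 - hazard t) * (\<alpha> - \<beta>)"
proof -
  let ?B = "risk_set t" and ?c = "contrast t"
  have "P.expectation (\<lambda>\<omega>. (\<Sum>i\<in>?B. ?c i * f (\<omega> i))\<^sup>2 * X \<omega>)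
      = P.expectation (\<lambda>\<omega>. \<Sum>i\<in>?B. \<Sum>j\<in>?B. ?c i * ?c j * (f (\<omega> i) * f (\<omega> j) * X \<omega>))"
    unfolding power2_eq_square sum_product unfolding sum_distrib_right
    by (intro Bochner_Integration.integral_cong refl sum.cong) (simp only: mult_ac)
  also have "\<dots> = (\<Sum>i\<in>?B. P.expectation (\<lambda>\<omega>. \<Sum>j\<in>?B. ?c i * ?c j * (f (\<omega> i) * f (\<omega> j) * X \<omega>)))"
    by (rule Bochner_Integration.integral_sum)
      (use X f risk_setD in \<open>auto intro!: bdd_rv_integrable bdd_rv_mult bdd_rv_const bdd_rv_sum\<close>)
  also have "\<dots> = (\<Sum>i\<in>?B. \<Sum>j\<in>?B. P.expectation (\<lambda>\<omega>. ?c i * ?c j * (f (\<omega> i) * f (\<omega> j) * X \<omega>)))"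
    by (intro sum.cong refl Bochner_Integration.integral_sum)
      (use X f risk_setD in \<open>auto intro!: bdd_rv_integrable bdd_rv_mult bdd_rv_const\<close>)
  also have "\<dots> = (\<Sum>i\<in>?B. \<Sum>j\<in>?B. ?c i * ?c j * \<beta> + (if j = i then ?c i * ?c j * (\<alpha> - \<beta>) else 0))"
    by (intro sum.cong refl) (auto simp: \<alpha> \<beta> right_diff_distrib)
  also have "\<dots> = (\<Sum>i\<in>?B. ?c i) * (\<Sum>i\<in>?B. ?c i) * \<beta> + (\<Sum>i\<in>?B. (?c i)\<^sup>2) * (\<alpha> - \<beta>)"
    by (simp add: sum.distrib sum_product sum_distrib_right[symmetric] power2_eq_square)
  also have "\<dots> = real (card (event_set t)) * (1 - hazard t) * (\<alpha> - \<beta>)"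
    by (simp add: sum_contrast sum_contrast_sq)
  finally show ?thesis .
qed

section \<open>Linearization of the logrank statistic\<close>

lemma finite_tvals [simp]: "finite (tvals n T)"
  by (simp add: tvals_def)

lemma tvals_nonneg: "t \<in> tvals n T \<Longrightarrow> 0 \<le> t"
  by (auto simp: tvals_def T_nonneg)

lemma sum_over_tvals: "(\<Sum>t\<in>tvals n T. \<Sum>i\<in>event_set t. f t i) = (\<Sum>i<n. f (T i) i)" for f :: "real \<Rightarrow> nat \<Rightarrow> real"
proof -
  have "(\<Sum>t\<in>tvals n T. \<Sum>i\<in>event_set t. f t i) = (\<Sum>t\<in>T ` {..<n}. \<Sum>i | i \<in> {..<n} \<and> T i = t. f (T i) i)"
    unfolding tvals_def event_set_def by (intro sum.cong) auto
  also have "\<dots> = (\<Sum>i<n. f (T i) i)"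
    by (rule sum.image_gen[symmetric]) simp
  finally show ?thesis .
qed

definition risk_count :: "real \<Rightarrow> outcome \<Rightarrow> real" where
  "risk_count t \<omega> = (\<Sum>i\<in>risk_set t. at_risk t (\<omega> i))"

definition event_count :: "real \<Rightarrow> outcome \<Rightarrow> real" where
  "event_count t \<omega> = (\<Sum>i\<in>event_set t. at_risk t (\<omega> i))"

definition score_sum :: "real \<Rightarrow> outcome \<Rightarrow> real" where
  "score_sum t \<omega> = (\<Sum>i\<in>risk_set t. score t (\<omega> i))"

definition linear_part :: "real \<Rightarrow> outcome \<Rightarrow> real" where
  "linear_part t \<omega> = (\<Sum>i\<in>risk_set t. contrast t i * score t (\<omega> i))"

definition remainder :: "real \<Rightarrow> outcome \<Rightarrow> real" where
  "remainder t \<omega> = (\<Sum>i\<in>risk_set t. contrast t i * at_risk t (\<omega> i)) * (score_sum t \<omega> * inverse (risk_count t \<omega>))"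

lemma card_eq_sum_of_bool: "real (card {i. i < n \<and> R i}) = (\<Sum>i<n. of_bool (R i))"
proof -
  have "{i. i < n \<and> R i} = {..<n} \<inter> {i. R i}"
    by auto
  then show ?thesis
    using sum.inter_restrict[of "{..<n}" "\<lambda>_. 1::real" "{i. R i}"] by (simp add: of_bool_def)
qed

lemma sum_risk_set: "(\<Sum>i\<in>risk_set t. f i) = (\<Sum>i<n. of_bool (t \<le> T i) * f i)"
  and sum_event_set: "(\<Sum>i\<in>event_set t. f i) = (\<Sum>i<n. of_bool (T i = t) * f i)" for f :: "nat \<Rightarrow> real"
proof -
  have "risk_set t = {..<n} \<inter> {i. t \<le> T i}" "event_set t = {..<n} \<inter> {i. T i = t}"
    by (auto simp: risk_set_def event_set_def)
  then show "(\<Sum>i\<in>risk_set t. f i) = (\<Sum>i<n. of_bool (t \<le> T i) * f i)"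
    "(\<Sum>i\<in>event_set t. f i) = (\<Sum>i<n. of_bool (T i = t) * f i)"
    by (simp_all add: sum.inter_restrict of_bool_def if_distrib[of "\<lambda>x. x * _"] cong: if_cong)
qed

lemma Wi_ge_iff: "i < n \<Longrightarrow> ennreal t \<le> Wi T1 T \<omega> i \<longleftrightarrow> t \<le> T i \<and> ennreal t \<le> Ci \<omega> i"
  by (simp add: Wi_def Ti_def null_hypothesis T_nonneg)

lemma event_iff:
  "i < n \<Longrightarrow> 0 \<le> t \<Longrightarrow> Deltai T1 T \<omega> i \<and> Wi T1 T \<omega> i = ennreal t \<longleftrightarrow> T i = t \<and> ennreal t \<le> Ci \<omega> i"
  by (auto simp: Wi_def Ti_def Deltai_def null_hypothesis T_nonneg min_def)

lemma at_risk_eq: "at_risk t (\<omega> i) = of_bool (ennreal t \<le> Ci \<omega> i)"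
  by (simp add: at_risk_def Ci_def Zi_def)

lemma treated_eq: "treated (\<omega> i) = of_bool (Zi \<omega> i)"
  by (simp add: treated_def Zi_def)

lemma N1_eq: "N1 n T1 T \<omega> t = (\<Sum>i\<in>risk_set t. at_risk t (\<omega> i) * treated (\<omega> i))"
  unfolding N1_def card_eq_sum_of_bool sum_risk_set
  by (rule sum.cong) (auto simp: Wi_ge_iff at_risk_eq treated_eq)

lemma Ntot_eq: "Ntot n T1 T \<omega> t = risk_count t \<omega>"
  unfolding Ntot_def N1_def N0_def card_eq_sum_of_bool risk_count_def sum_risk_set sum.distrib[symmetric]
  by (rule sum.cong) (auto simp: Wi_ge_iff at_risk_eq)

lemma D1_eq: "0 \<le> t \<Longrightarrow> D1 n T1 T \<omega> t = (\<Sum>i\<in>event_set t. at_risk t (\<omega> i) * treated (\<omega> i))"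
  unfolding D1_def card_eq_sum_of_bool sum_event_set
  by (rule sum.cong) (auto simp: event_iff at_risk_eq treated_eq)

lemma Dtot_eq: "0 \<le> t \<Longrightarrow> Dtot n T1 T \<omega> t = event_count t \<omega>"
  unfolding Dtot_def card_eq_sum_of_bool event_count_def sum_event_set
  by (rule sum.cong) (auto simp: event_iff at_risk_eq)

lemma risk_count_eq_0D: "risk_count t \<omega> = 0 \<Longrightarrow> i \<in> risk_set t \<Longrightarrow> at_risk t (\<omega> i) = 0"
  unfolding risk_count_def by (subst (asm) sum_nonneg_eq_0_iff) (auto simp: at_risk_nonneg)

lemma score_eq_0_if_not_at_risk: "at_risk t w = 0 \<Longrightarrow> score t w = 0"
  by (simp add: score_def)

lemma N1_eq_score_sum: "N1 n T1 T \<omega> t = score_sum t \<omega> + treat_prob t * risk_count t \<omega>"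
  unfolding N1_eq score_sum_def risk_count_def
  by (simp add: score_def right_diff_distrib sum_subtractf sum_distrib_left mult_ac)

lemma logrank_term_eq:
  assumes "0 \<le> t"
  shows "D1 n T1 T \<omega> t - Mk n T1 T \<omega> t = linear_part t \<omega> - remainder t \<omega>"
proof -
  have D1: "D1 n T1 T \<omega> t = (\<Sum>i\<in>event_set t. score t (\<omega> i)) + treat_prob t * event_count t \<omega>"
    unfolding D1_eq[OF assms] event_count_def
    by (simp add: score_def right_diff_distrib sum_subtractf sum_distrib_left mult_ac)
  have lin: "linear_part t \<omega> = (\<Sum>i\<in>event_set t. score t (\<omega> i)) - hazard t * score_sum t \<omega>"
    unfolding linear_part_def score_sum_def by (rule sum_contrast_mult)
  have rem: "remainder t \<omega> = (event_count t \<omega> - hazard t * risk_count t \<omega>)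
      * (score_sum t \<omega> * inverse (risk_count t \<omega>))"
    unfolding remainder_def event_count_def risk_count_def by (simp only: sum_contrast_mult)
  show ?thesis
  proof (cases "risk_count t \<omega> = 0")
    case True
    have "event_count t \<omega> = 0" "score_sum t \<omega> = 0" "(\<Sum>i\<in>event_set t. score t (\<omega> i)) = 0"
      unfolding event_count_def score_sum_def
      using risk_count_eq_0D[OF True] event_set_subset[of t]
      by (auto intro!: sum.neutral score_eq_0_if_not_at_risk)
    with True show ?thesis
      by (simp add: D1 lin rem Mk_def Ntot_eq)
  next
    case False
    then show ?thesis
      by (simp add: D1 lin rem Mk_def Ntot_eq N1_eq_score_sum Dtot_eq assms field_simps)
  qed
qed

lemma Lstat_eq: "Lstat n T1 T \<omega> = (\<Sum>t\<in>tvals n T. linear_part t \<omega>) - (\<Sum>t\<in>tvals n T. remainder t \<omega>)"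
  unfolding Lstat_def sum_subtractf[symmetric] by (rule sum.cong) (auto simp: logrank_term_eq tvals_nonneg)

lemma risk_count_Ints: "risk_count t \<omega> \<in> \<int>"
  unfolding risk_count_def by (rule Ints_sum) (rule at_risk_Ints)

lemma event_count_Ints: "event_count t \<omega> \<in> \<int>"
  unfolding event_count_def by (rule Ints_sum) (rule at_risk_Ints)

lemma risk_count_nonneg: "0 \<le> risk_count t \<omega>"
  unfolding risk_count_def by (rule sum_nonneg) (rule at_risk_nonneg)

lemma event_count_nonneg: "0 \<le> event_count t \<omega>"
  unfolding event_count_def by (rule sum_nonneg) (rule at_risk_nonneg)

lemma event_count_le_risk_count: "event_count t \<omega> \<le> risk_count t \<omega>"
  unfolding event_count_def risk_count_def by (rule sum_mono2) (auto simp: at_risk_nonneg event_set_subset[THEN subsetD])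

lemma event_count_le_card: "event_count t \<omega> \<le> real (card (event_set t))"
  unfolding event_count_def using sum_mono[of "event_set t" "\<lambda>i. at_risk t (\<omega> i)" "\<lambda>_. 1"] at_risk_le_1 by simp

lemma bdd_rv_risk_count [intro]: "bdd_rv (risk_count t)"
  unfolding risk_count_def by (intro bdd_rv_sum bdd_rv_at_risk risk_setD)

lemma bdd_rv_event_count [intro]: "bdd_rv (event_count t)"
  unfolding event_count_def by (intro bdd_rv_sum bdd_rv_at_risk event_setD)

lemma bdd_rv_inverse_risk_count [intro]: "bdd_rv (\<lambda>\<omega>. inverse (risk_count t \<omega>))"
  by (auto intro: risk_count_Ints)

lemma bdd_rv_score_sum [intro]: "bdd_rv (score_sum t)"
  unfolding score_sum_def by (intro bdd_rv_sum bdd_rv_score risk_setD)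

lemma bdd_rv_linear_part [intro]: "bdd_rv (linear_part t)"
  unfolding linear_part_def by (intro bdd_rv_sum bdd_rv_mult bdd_rv_const bdd_rv_score risk_setD)

lemma bdd_rv_remainder [intro]: "bdd_rv (remainder t)"
  unfolding remainder_def by (intro bdd_rv_mult bdd_rv_sum bdd_rv_const bdd_rv_at_risk
      bdd_rv_score_sum bdd_rv_inverse_risk_count) (rule risk_setD)

lemma risk_set_antimono: "s \<le> t \<Longrightarrow> risk_set t \<subseteq> risk_set s"
  by (auto simp: risk_set_def)

lemma exchangeable_risk_count: "s \<le> t \<Longrightarrow> exchangeable t (risk_count s)"
  unfolding risk_count_def
  using exchangeable_sum[of t "risk_set s" "\<lambda>_. 1" 1 "at_risk s"] risk_set_antimono[of s t] by simp

lemma exchangeable_score_sum: "s \<le> t \<Longrightarrow> exchangeable t (score_sum s)"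
  unfolding score_sum_def
  using exchangeable_sum[of t "risk_set s" "\<lambda>_. 1" 1 "score s"] risk_set_antimono[of s t] by simp

lemma exchangeable_contrast: "s < t \<Longrightarrow> exchangeable t (\<lambda>\<omega>. \<Sum>i\<in>risk_set s. contrast s i * f (\<omega> i))"
  by (rule exchangeable_sum[where ?c0.0="- hazard s"]) (auto simp: contrast_def risk_set_def)

lemma exchangeable_remainder: "s < t \<Longrightarrow> exchangeable t (remainder s)"
  unfolding remainder_def
  by (intro exchangeable_mult exchangeable_contrast exchangeable_score_sum
      exchangeable_comp[where f=inverse] exchangeable_risk_count) auto

lemma expectation_linear_part_mult:
  assumes "s < t"
  shows "P.expectation (\<lambda>\<omega>. linear_part t \<omega> * linear_part s \<omega>) = 0"
proof -
  have "exchangeable t (linear_part s)"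
    unfolding linear_part_def by (rule exchangeable_contrast[OF assms])
  then show ?thesis
    using expectation_contrast_eq_0[of t "linear_part s" "score t"] by (auto simp: linear_part_def[of t])
qed

lemma expectation_remainder_mult:
  assumes "s < t"
  shows "P.expectation (\<lambda>\<omega>. remainder t \<omega> * remainder s \<omega>) = 0"
proof -
  let ?X = "\<lambda>\<omega>. score_sum t \<omega> * inverse (risk_count t \<omega>) * remainder s \<omega>"
  have "exchangeable t ?X"
    by (intro exchangeable_mult exchangeable_score_sum exchangeable_comp[where f=inverse]
        exchangeable_risk_count exchangeable_remainder assms order_refl)
  from expectation_contrast_eq_0[OF this bdd_rv_mult[OF bdd_rv_mult[OF bdd_rv_score_sum bdd_rv_inverse_risk_count]
      bdd_rv_remainder] bdd_rv_at_risk]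
  show ?thesis
    by (simp add: remainder_def[of t] mult.assoc)
qed

lemma expectation_remainder: "P.expectation (remainder t) = 0"
proof -
  let ?X = "\<lambda>\<omega>. score_sum t \<omega> * inverse (risk_count t \<omega>)"
  have "exchangeable t ?X"
    by (intro exchangeable_mult exchangeable_score_sum exchangeable_comp[where f=inverse]
        exchangeable_risk_count order_refl)
  from expectation_contrast_eq_0[OF this bdd_rv_mult[OF bdd_rv_score_sum bdd_rv_inverse_risk_count] bdd_rv_at_risk]
  show ?thesis
    unfolding remainder_def by simp
qed

lemma expectation_linear_part: "P.expectation (linear_part t) = 0"
  using expectation_contrast_eq_0[OF exchangeable_const[of t 1] bdd_rv_const bdd_rv_score]
  unfolding linear_part_def by simp

lemma expectation_sum_orthogonal_sq:
  assumes fin: "finite I" and bdd: "\<And>t. bdd_rv (Y t)"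
    and orth: "\<And>s t :: real. s < t \<Longrightarrow> P.expectation (\<lambda>\<omega>. Y t \<omega> * Y s \<omega>) = 0"
  shows "P.expectation (\<lambda>\<omega>. (\<Sum>t\<in>I. Y t \<omega>)\<^sup>2) = (\<Sum>t\<in>I. P.expectation (\<lambda>\<omega>. (Y t \<omega>)\<^sup>2))"
proof -
  have *: "P.expectation (\<lambda>\<omega>. Y t \<omega> * Y s \<omega>) = (if s = t then P.expectation (\<lambda>\<omega>. (Y t \<omega>)\<^sup>2) else 0)" for s t
    using orth[of s t] orth[of t s] by (auto simp: power2_eq_square mult.commute neq_iff)
  have "P.expectation (\<lambda>\<omega>. (\<Sum>t\<in>I. Y t \<omega>)\<^sup>2) = P.expectation (\<lambda>\<omega>. \<Sum>t\<in>I. \<Sum>s\<in>I. Y t \<omega> * Y s \<omega>)"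
    by (simp add: power2_eq_square sum_product)
  also have "\<dots> = (\<Sum>t\<in>I. \<Sum>s\<in>I. P.expectation (\<lambda>\<omega>. Y t \<omega> * Y s \<omega>))"
    using bdd by (subst Bochner_Integration.integral_sum; intro sum.cong refl bdd_rv_integrable bdd_rv_sum
      bdd_rv_mult Bochner_Integration.integral_sum)
  finally show ?thesis
    by (simp add: * fin)
qed

lemma expectation_score_mult:
  assumes "i < n" "j < n" "i \<noteq> j"
  shows "P.expectation (\<lambda>\<omega>. score t (\<omega> i) * score t (\<omega> j)) = 0"
  by (rule expectation_eq_0_if_component_integral_eq_0[of i]) (use assms integral_score in auto)

lemma expectation_linear_part_sq:
  "P.expectation (\<lambda>\<omega>. (linear_part t \<omega>)\<^sup>2) = real (card (event_set t)) * (1 - hazard t) * score_var t"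
proof -
  have "P.expectation (\<lambda>\<omega>. score t (\<omega> i) * score t (\<omega> i)) = score_var t" if "i < n" for i
    using expectation_component[of i "\<lambda>w. score t w * score t w"] integral_score_sq[of t] that
    by (simp add: power2_eq_square)
  then show ?thesis
    using expectation_contrast_sq[of "\<lambda>_. 1" "score t" t "score_var t" 0]
    by (auto simp: linear_part_def expectation_score_mult risk_setD)
qed

lemma expectation_score_sum_sq_div_le: "P.expectation (\<lambda>\<omega>. (score_sum t \<omega>)\<^sup>2 * inverse (risk_count t \<omega>)) \<le> 1"
proof -
  let ?B = "risk_set t" and ?R = "\<lambda>\<omega>. inverse (risk_count t \<omega>)"
  have cross: "P.expectation (\<lambda>\<omega>. score t (\<omega> i) * score t (\<omega> j) * ?R \<omega>) = 0"
    if ij: "i \<in> ?B" "j \<in> ?B" "i \<noteq> j" for i j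
  proof (rule expectation_eq_0_if_component_integral_eq_0[of i])
    show "i < n"
      using ij by (simp add: risk_setD)
    show "bdd_rv (\<lambda>\<omega>. score t (\<omega> i) * score t (\<omega> j) * ?R \<omega>)"
      using ij by (intro bdd_rv_mult bdd_rv_score bdd_rv_inverse_risk_count risk_setD)
    fix x :: outcome
    have "risk_count t (x(i := w)) = at_risk t w + (\<Sum>k\<in>?B - {i}. at_risk t (x k))" for w
      unfolding risk_count_def using ij by (subst sum.remove[of _ i]) (auto intro!: sum.cong)
    \<comment> \<open>Where the score of unit \<open>i\<close> is nonzero, unit \<open>i\<close> contributes exactly \<open>1\<close> to the risk count.\<close>
    then have "score t w * score t (x j) * ?R (x(i := w))
        = score t w * (score t (x j) * inverse (1 + (\<Sum>k\<in>?B - {i}. at_risk t (x k))))" for w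
      using at_risk_cases[of t w] by (auto simp: score_eq_0_if_not_at_risk)
    then have "(\<integral>w. score t w * score t (x j) * ?R (x(i := w)) \<partial>unit_law) = 0"
      using integral_score by (simp only: integral_mult_left_zero mult_zero_left)
    then show "(\<integral>w. score t ((x(i := w)) i) * score t ((x(i := w)) j) * ?R (x(i := w)) \<partial>unit_law) = 0"
      using ij by simp
  qed
  have "P.expectation (\<lambda>\<omega>. (score_sum t \<omega>)\<^sup>2 * ?R \<omega>)
      = P.expectation (\<lambda>\<omega>. \<Sum>i\<in>?B. \<Sum>j\<in>?B. score t (\<omega> i) * score t (\<omega> j) * ?R \<omega>)"
    unfolding power2_eq_square score_sum_def sum_product unfolding sum_distrib_right ..
  also have "\<dots> = (\<Sum>i\<in>?B. P.expectation (\<lambda>\<omega>. \<Sum>j\<in>?B. score t (\<omega> i) * score t (\<omega> j) * ?R \<omega>))"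
    by (rule Bochner_Integration.integral_sum)
      (auto intro!: bdd_rv_integrable bdd_rv_sum bdd_rv_mult bdd_rv_score bdd_rv_inverse_risk_count risk_setD)
  also have "\<dots> = (\<Sum>i\<in>?B. \<Sum>j\<in>?B. P.expectation (\<lambda>\<omega>. score t (\<omega> i) * score t (\<omega> j) * ?R \<omega>))"
    by (intro sum.cong refl Bochner_Integration.integral_sum)
      (auto intro!: bdd_rv_integrable bdd_rv_sum bdd_rv_mult bdd_rv_score bdd_rv_inverse_risk_count risk_setD)
  also have "\<dots> = (\<Sum>i\<in>?B. \<Sum>j\<in>?B. if j = i then P.expectation (\<lambda>\<omega>. (score t (\<omega> i))\<^sup>2 * ?R \<omega>) else 0)"
    by (intro sum.cong refl) (auto simp: cross power2_eq_square)
  also have "\<dots> = (\<Sum>i\<in>?B. P.expectation (\<lambda>\<omega>. (score t (\<omega> i))\<^sup>2 * ?R \<omega>))"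
    by simp
  also have "\<dots> = P.expectation (\<lambda>\<omega>. \<Sum>i\<in>?B. (score t (\<omega> i))\<^sup>2 * ?R \<omega>)"
    by (rule Bochner_Integration.integral_sum[symmetric])
      (auto intro!: bdd_rv_integrable bdd_rv_mult bdd_rv_score bdd_rv_power2 bdd_rv_inverse_risk_count risk_setD)
  also have "\<dots> \<le> P.expectation (\<lambda>_. 1)"
  proof (rule integral_mono)
    show "integrable P (\<lambda>\<omega>. \<Sum>i\<in>?B. (score t (\<omega> i))\<^sup>2 * ?R \<omega>)"
      by (auto intro!: bdd_rv_integrable bdd_rv_sum bdd_rv_mult bdd_rv_score bdd_rv_power2 bdd_rv_inverse_risk_count risk_setD)
    fix \<omega>
    have "(\<Sum>i\<in>?B. (score t (\<omega> i))\<^sup>2 * ?R \<omega>) \<le> (\<Sum>i\<in>?B. at_risk t (\<omega> i) * ?R \<omega>)"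
      using risk_count_nonneg[of t \<omega>] by (intro sum_mono mult_right_mono score_sq_le_at_risk) simp
    also have "\<dots> = risk_count t \<omega> * ?R \<omega>"
      by (simp add: risk_count_def sum_distrib_right)
    also have "\<dots> \<le> 1"
      by (cases "risk_count t \<omega> = 0") auto
    finally show "(\<Sum>i\<in>?B. (score t (\<omega> i))\<^sup>2 * ?R \<omega>) \<le> 1" .
  qed auto
  also have "\<dots> = 1"
    using P.prob_space by simp
  finally show ?thesis .
qed

lemma expectation_remainder_sq_le:
  "P.expectation (\<lambda>\<omega>. (remainder t \<omega>)\<^sup>2) \<le> hazard t"
proof (cases "risk_set t = {}")
  case True
  then show ?thesis
    by (simp add: remainder_def hazard_nonneg)
next
  case False
  let ?B = "risk_set t" and ?S = "\<lambda>\<omega>. (score_sum t \<omega>)\<^sup>2 * inverse (risk_count t \<omega>)"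
  obtain k where k: "k \<in> ?B" using False by auto
  define X where "X = (\<lambda>\<omega>. (score_sum t \<omega> * inverse (risk_count t \<omega>))\<^sup>2)"
  define \<alpha> where "\<alpha> = P.expectation (\<lambda>\<omega>. at_risk t (\<omega> k) * X \<omega>)"
  define pair where "pair i j = P.expectation (\<lambda>\<omega>. at_risk t (\<omega> i) * at_risk t (\<omega> j) * X \<omega>)" for i j
  have exch: "exchangeable t X"
    unfolding X_def power2_eq_square
    by (intro exchangeable_mult exchangeable_score_sum exchangeable_comp[where f=inverse]
        exchangeable_risk_count order_refl)
  have bdd: "bdd_rv X"
    unfolding X_def by (intro bdd_rv_power2 bdd_rv_mult bdd_rv_score_sum bdd_rv_inverse_risk_count)
  have X_nonneg: "0 \<le> X \<omega>" for \<omega>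
    by (simp add: X_def)
  have pair_nonneg: "0 \<le> pair i j" for i j
    unfolding pair_def by (intro integral_nonneg_AE AE_I2 mult_nonneg_nonneg at_risk_nonneg X_nonneg)
  obtain \<beta> where \<beta>: "0 \<le> \<beta>" "\<And>i j. i \<in> ?B \<Longrightarrow> j \<in> ?B \<Longrightarrow> i \<noteq> j \<Longrightarrow> pair i j = \<beta>"
  proof (cases "\<exists>i\<in>?B. \<exists>j\<in>?B. i \<noteq> j")
    case True
    then obtain i j where ij: "i \<in> ?B" "j \<in> ?B" "i \<noteq> j" by blast
    show ?thesis
      by (rule that[of "pair i j"])
        (use pair_nonneg expectation_exchange_pair[OF exch bdd _ _ ij(1,2) _ ij(3) bdd_rv_at_risk] in \<open>auto simp: pair_def\<close>)
  next
    case False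
    then show ?thesis
      using that[of 0] by blast
  qed
  have \<alpha>_eq: "P.expectation (\<lambda>\<omega>. at_risk t (\<omega> i) * at_risk t (\<omega> i) * X \<omega>) = \<alpha>" if "i \<in> ?B" for i
    unfolding at_risk_idem \<alpha>_def by (rule expectation_exchange[OF exch bdd that k]) auto
  have "P.expectation (\<lambda>\<omega>. (remainder t \<omega>)\<^sup>2)
      = P.expectation (\<lambda>\<omega>. (\<Sum>i\<in>?B. contrast t i * at_risk t (\<omega> i))\<^sup>2 * X \<omega>)"
    by (simp only: remainder_def X_def power_mult_distrib)
  also have "\<dots> = real (card (event_set t)) * (1 - hazard t) * (\<alpha> - \<beta>)"
    by (rule expectation_contrast_sq[OF bdd _ \<alpha>_eq]) (use \<beta> in \<open>auto simp: pair_def\<close>)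
  also have "\<dots> \<le> real (card (event_set t)) * 1 * \<alpha>"
  proof -
    have "0 \<le> \<alpha>"
      unfolding \<alpha>_def by (intro integral_nonneg_AE AE_I2 mult_nonneg_nonneg at_risk_nonneg X_nonneg)
    have "(1 - hazard t) * (\<alpha> - \<beta>) \<le> (1 - hazard t) * \<alpha>"
      using \<beta>(1) hazard_le_1[of t] by (intro mult_left_mono) auto
    also have "\<dots> \<le> 1 * \<alpha>"
      using \<open>0 \<le> \<alpha>\<close> hazard_nonneg[of t] by (intro mult_right_mono) auto
    finally show ?thesis
      by (simp add: mult.assoc mult_left_mono)
  qed
  also have "\<dots> = hazard t * (real (card ?B) * \<alpha>)"
    using hazard_mult_card[of t] by simp
  also have "real (card ?B) * \<alpha> = P.expectation (\<lambda>\<omega>. risk_count t \<omega> * X \<omega>)"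
    using expectation_weighted_sum[OF exch bdd bdd_rv_at_risk k, of "\<lambda>_. 1"]
    by (simp add: \<alpha>_def risk_count_def)
  also have "\<dots> = P.expectation ?S"
    by (rule arg_cong[where f="integral\<^sup>L P"]) (auto simp: X_def fun_eq_iff power2_eq_square)
  also have "hazard t * \<dots> \<le> hazard t * 1"
    by (intro mult_left_mono expectation_score_sum_sq_div_le hazard_nonneg)
  finally show ?thesis by simp
qed

end

section \<open>Moment bounds\<close>

lemma sum_inverse_upper_card_le_harm:
  fixes T :: "nat \<Rightarrow> real"
  assumes "finite I"
  shows "(\<Sum>i\<in>I. 1 / real (card {j \<in> I. T i \<le> T j})) \<le> harm (card I)"
  using assms
proof (induction "card I" arbitrary: I)
  case 0
  then show ?case by (simp add: harm_def)
next
  case (Suc k)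
  then have "I \<noteq> {}" by auto
  define i0 where "i0 = arg_min_on T I"
  have i0: "i0 \<in> I" "\<And>j. j \<in> I \<Longrightarrow> T i0 \<le> T j"
    using arg_min_if_finite[OF \<open>finite I\<close> \<open>I \<noteq> {}\<close>, of T] by (auto simp: i0_def not_less)
  let ?J = "I - {i0}"
  have J: "finite ?J" "card ?J = k"
    using Suc i0 by auto
  have "(\<Sum>i\<in>I. 1 / real (card {j \<in> I. T i \<le> T j}))
      = 1 / real (card {j \<in> I. T i0 \<le> T j}) + (\<Sum>i\<in>?J. 1 / real (card {j \<in> I. T i \<le> T j}))"
    using i0 Suc.prems by (simp add: sum.remove)
  also have "{j \<in> I. T i0 \<le> T j} = I"
    using i0 by auto
  also have "(\<Sum>i\<in>?J. 1 / real (card {j \<in> I. T i \<le> T j})) \<le> (\<Sum>i\<in>?J. 1 / real (card {j \<in> ?J. T i \<le> T j}))"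
  proof (rule sum_mono)
    fix i assume i: "i \<in> ?J"
    have "0 < card {j \<in> ?J. T i \<le> T j}"
      using i J(1) by (auto simp: card_gt_0_iff)
    moreover have "card {j \<in> ?J. T i \<le> T j} \<le> card {j \<in> I. T i \<le> T j}"
      using Suc.prems by (intro card_mono) auto
    ultimately show "1 / real (card {j \<in> I. T i \<le> T j}) \<le> 1 / real (card {j \<in> ?J. T i \<le> T j})"
      by (intro divide_left_mono) auto
  qed
  also have "\<dots> \<le> harm k"
    using Suc.hyps(1)[of ?J] J by simp
  finally have "(\<Sum>i\<in>I. 1 / real (card {j \<in> I. T i \<le> T j})) \<le> 1 / real (card I) + harm k"
    by simp
  also have "\<dots> = harm (card I)"
    unfolding Suc.hyps(2)[symmetric] by (simp add: harm_Suc inverse_eq_divide)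
  finally show ?case .
qed

context logrank_population
begin

definition total_hazard :: real where
  "total_hazard = (\<Sum>t\<in>tvals n T. hazard t)"

definition total_var :: real where
  "total_var = (\<Sum>t\<in>tvals n T. real (card (event_set t)) * score_var t)"

lemma total_hazard_nonneg: "0 \<le> total_hazard"
  unfolding total_hazard_def by (intro sum_nonneg hazard_nonneg)

lemma total_hazard_le_harm: "total_hazard \<le> harm n"
proof -
  have "total_hazard = (\<Sum>t\<in>tvals n T. \<Sum>i\<in>event_set t. 1 / real (card (risk_set t)))"
    by (simp add: total_hazard_def hazard_def)
  also have "\<dots> = (\<Sum>i<n. 1 / real (card {j \<in> {..<n}. T i \<le> T j}))"
    unfolding sum_over_tvals risk_set_def by simp
  also have "\<dots> \<le> harm n"
    using sum_inverse_upper_card_le_harm[of "{..<n}" T] by simp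
  finally show ?thesis .
qed

lemma total_var_eq: "total_var = (\<Sum>i<n. score_var (T i))"
  unfolding total_var_def using sum_over_tvals[of "\<lambda>t _. score_var t"] by simp

lemma total_var_ge: "p * (1 - p) * (real n * gtilde n T Q) \<le> total_var"
proof -
  have "p * (1 - p) * (real n * gtilde n T Q) = (\<Sum>i<n. p * (1 - p) * Gtilde Q (T i))"
    by (cases "n = 0") (simp_all add: gtilde_def sum_distrib_left[symmetric])
  also have "\<dots> \<le> total_var"
    unfolding total_var_eq by (intro sum_mono score_var_ge)
  finally show ?thesis .
qed

lemma card_event_set_le_dtilde: "t \<in> tvals n T \<Longrightarrow> real (card (event_set t)) \<le> dtilde n T"
  unfolding dtilde_def event_set_def dcount_def by (intro of_nat_mono Max_ge) auto

lemma dtilde_nonneg: "0 \<le> dtilde n T"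
  by (simp add: dtilde_def)

definition linear_stat :: "outcome \<Rightarrow> real" where
  "linear_stat \<omega> = (\<Sum>t\<in>tvals n T. linear_part t \<omega>)"

lemma bdd_rv_linear_stat: "bdd_rv linear_stat"
  unfolding linear_stat_def by (intro bdd_rv_sum bdd_rv_linear_part)

lemma bdd_rv_Lstat: "bdd_rv (Lstat n T1 T)"
  unfolding Lstat_eq by (intro bdd_rv_diff bdd_rv_sum bdd_rv_linear_part bdd_rv_remainder)

lemma expectation_Lstat: "P.expectation (Lstat n T1 T) = 0"
proof -
  have "P.expectation (Lstat n T1 T)
      = (\<Sum>t\<in>tvals n T. P.expectation (linear_part t)) - (\<Sum>t\<in>tvals n T. P.expectation (remainder t))"
    unfolding Lstat_eq
    by (simp add: Bochner_Integration.integral_sum bdd_rv_integrable bdd_rv_linear_part bdd_rv_remainder)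
  then show ?thesis
    by (simp add: expectation_linear_part expectation_remainder)
qed

lemma pvariance_Lstat: "pvariance P (Lstat n T1 T) = P.expectation (\<lambda>\<omega>. (Lstat n T1 T \<omega>)\<^sup>2)"
  by (simp add: pvariance_def expectation_Lstat)

lemma expectation_Lstat_diff_sq_le:
  "P.expectation (\<lambda>\<omega>. (Lstat n T1 T \<omega> - linear_stat \<omega>)\<^sup>2) \<le> total_hazard"
proof -
  have "P.expectation (\<lambda>\<omega>. (Lstat n T1 T \<omega> - linear_stat \<omega>)\<^sup>2)
      = P.expectation (\<lambda>\<omega>. (\<Sum>t\<in>tvals n T. remainder t \<omega>)\<^sup>2)"
    unfolding Lstat_eq linear_stat_def by simp
  also have "\<dots> = (\<Sum>t\<in>tvals n T. P.expectation (\<lambda>\<omega>. (remainder t \<omega>)\<^sup>2))"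
    by (rule expectation_sum_orthogonal_sq[OF finite_tvals bdd_rv_remainder expectation_remainder_mult])
  also have "\<dots> \<le> total_hazard"
    unfolding total_hazard_def by (intro sum_mono expectation_remainder_sq_le)
  finally show ?thesis .
qed

lemma expectation_linear_stat_sq:
  "P.expectation (\<lambda>\<omega>. (linear_stat \<omega>)\<^sup>2)
    = (\<Sum>t\<in>tvals n T. real (card (event_set t)) * (1 - hazard t) * score_var t)"
  unfolding linear_stat_def
  by (simp add: expectation_sum_orthogonal_sq[OF finite_tvals bdd_rv_linear_part expectation_linear_part_mult]
      expectation_linear_part_sq)

lemma expectation_linear_stat_sq_le: "P.expectation (\<lambda>\<omega>. (linear_stat \<omega>)\<^sup>2) \<le> total_var"
  unfolding expectation_linear_stat_sq total_var_def
proof (rule sum_mono)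
  fix t
  have "real (card (event_set t)) * (1 - hazard t) \<le> real (card (event_set t)) * 1"
    using hazard_nonneg[of t] by (intro mult_left_mono) auto
  then show "real (card (event_set t)) * (1 - hazard t) * score_var t \<le> real (card (event_set t)) * score_var t"
    using score_var_nonneg[of t] by (intro mult_right_mono) auto
qed

lemma expectation_linear_stat_sq_ge:
  "total_var - dtilde n T * total_hazard \<le> P.expectation (\<lambda>\<omega>. (linear_stat \<omega>)\<^sup>2)"
proof -
  have "(\<Sum>t\<in>tvals n T. real (card (event_set t)) * score_var t * hazard t) \<le> (\<Sum>t\<in>tvals n T. dtilde n T * 1 * hazard t)"
    by (intro sum_mono mult_right_mono mult_mono card_event_set_le_dtilde score_var_le_1 score_var_nonneg
        hazard_nonneg dtilde_nonneg)
  then show ?thesis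
    unfolding expectation_linear_stat_sq total_var_def total_hazard_def
    by (simp add: algebra_simps sum_subtractf sum_distrib_left sum_distrib_right)
qed

lemma expectation_abs_le_sqrt:
  assumes "bdd_rv X"
  shows "P.expectation (\<lambda>\<omega>. \<bar>X \<omega>\<bar>) \<le> sqrt (P.expectation (\<lambda>\<omega>. (X \<omega>)\<^sup>2))"
proof -
  have "0 \<le> P.variance (\<lambda>\<omega>. \<bar>X \<omega>\<bar>)"
    by (rule P.variance_positive)
  also have "\<dots> = P.expectation (\<lambda>\<omega>. (X \<omega>)\<^sup>2) - (P.expectation (\<lambda>\<omega>. \<bar>X \<omega>\<bar>))\<^sup>2"
    using assms by (subst P.variance_eq) (auto intro!: bdd_rv_integrable)
  finally show ?thesis
    by (intro real_le_rsqrt) simp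
qed

lemma expectation_score_sum_sq:
  "P.expectation (\<lambda>\<omega>. (score_sum t \<omega>)\<^sup>2) = real (card (risk_set t)) * score_var t"
  unfolding score_sum_def
  by (subst expectation_sum_centered_sq[OF risk_set_subset, where b="\<lambda>_. 1"])
    (auto simp: integral_score integral_score_sq abs_score_le_1)

lemma expectation_event_count_score_le:
  "P.expectation (\<lambda>\<omega>. event_count t \<omega> * (\<bar>score_sum t \<omega>\<bar> * inverse (risk_count t \<omega>)))
    \<le> sqrt (hazard t) * sqrt (real (card (event_set t)) * score_var t)"
proof -
  let ?X = "\<lambda>\<omega>. \<bar>score_sum t \<omega>\<bar> * inverse (risk_count t \<omega>)"
  have exch: "exchangeable t ?X"
    by (intro exchangeable_mult exchangeable_comp[where f=abs] exchangeable_comp[where f=inverse]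
        exchangeable_score_sum exchangeable_risk_count order_refl)
  have bdd: "bdd_rv ?X"
    by (intro bdd_rv_mult bdd_rv_abs bdd_rv_score_sum bdd_rv_inverse_risk_count)
  have "P.expectation (\<lambda>\<omega>. event_count t \<omega> * ?X \<omega>) = hazard t * P.expectation (\<lambda>\<omega>. risk_count t \<omega> * ?X \<omega>)"
    unfolding event_count_def using expectation_event_sum[OF exch bdd bdd_rv_at_risk] by (simp add: risk_count_def)
  also have "P.expectation (\<lambda>\<omega>. risk_count t \<omega> * ?X \<omega>) \<le> P.expectation (\<lambda>\<omega>. \<bar>score_sum t \<omega>\<bar>)"
  proof (rule integral_mono)
    fix \<omega>
    show "risk_count t \<omega> * ?X \<omega> \<le> \<bar>score_sum t \<omega>\<bar>"
      by (cases "risk_count t \<omega> = 0") (auto simp: field_simps)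
  qed (use bdd in \<open>auto intro!: bdd_rv_integrable\<close>)
  also have "\<dots> \<le> sqrt (real (card (risk_set t)) * score_var t)"
    using expectation_abs_le_sqrt[OF bdd_rv_score_sum, of t] by (simp add: expectation_score_sum_sq)
  also have "hazard t * \<dots> = sqrt (hazard t) * sqrt (hazard t * real (card (risk_set t)) * score_var t)"
    using hazard_nonneg[of t] by (simp add: real_sqrt_mult flip: mult.assoc)
  finally show ?thesis
    by (simp add: hazard_mult_card mult_left_mono hazard_nonneg)
qed

lemma expectation_event_risk_ratio_le:
  "P.expectation (\<lambda>\<omega>. event_count t \<omega> * inverse (risk_count t \<omega>)) \<le> hazard t"
proof -
  let ?X = "\<lambda>\<omega>. inverse (risk_count t \<omega>)"
  have exch: "exchangeable t ?X"
    by (intro exchangeable_comp[where f=inverse] exchangeable_risk_count order_refl)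
  have "P.expectation (\<lambda>\<omega>. event_count t \<omega> * ?X \<omega>) = hazard t * P.expectation (\<lambda>\<omega>. risk_count t \<omega> * ?X \<omega>)"
    unfolding event_count_def using expectation_event_sum[OF exch bdd_rv_inverse_risk_count bdd_rv_at_risk]
    by (simp add: risk_count_def)
  also have "P.expectation (\<lambda>\<omega>. risk_count t \<omega> * ?X \<omega>) \<le> P.expectation (\<lambda>_. 1)"
  proof (rule integral_mono)
    fix \<omega>
    show "risk_count t \<omega> * ?X \<omega> \<le> 1"
      by (cases "risk_count t \<omega> = 0") auto
  qed (auto intro!: bdd_rv_integrable)
  finally show ?thesis
    using P.prob_space by (simp add: mult_left_mono hazard_nonneg)
qed

lemma Vk_approx:
  assumes t: "t \<in> tvals n T"
  shows "\<bar>Vk n T1 T \<omega> t - treat_prob t * (1 - treat_prob t) * event_count t \<omega>\<bar>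
    \<le> event_count t \<omega> * (\<bar>score_sum t \<omega>\<bar> * inverse (risk_count t \<omega>))
      + dtilde n T * (event_count t \<omega> * inverse (risk_count t \<omega>))"
proof -
  define e N D S where "e = treat_prob t" "N = risk_count t \<omega>" "D = event_count t \<omega>" "S = score_sum t \<omega>"
  note defs = this
  have e: "0 \<le> e" "e \<le> 1"
    by (auto simp: defs treat_prob_nonneg treat_prob_le_1)
  have D: "0 \<le> D" "D \<le> N" "D \<le> dtilde n T" "D \<in> \<int>" "N \<in> \<int>"
    using event_count_le_card[of t \<omega>] card_event_set_le_dtilde[OF t]
    by (auto simp: defs event_count_nonneg event_count_le_risk_count event_count_Ints risk_count_Ints)
  define x where "x = N1 n T1 T \<omega> t / N"
  have N0: "N0 n T1 T \<omega> t = N - N1 n T1 T \<omega> t"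
    using Ntot_eq[of \<omega> t] by (simp add: Ntot_def defs)
  have N1_bounds: "0 \<le> N1 n T1 T \<omega> t" "N1 n T1 T \<omega> t \<le> N"
    using N0 by (auto simp: N1_def N0_def)
  have V: "Vk n T1 T \<omega> t = D * (N - D) * N1 n T1 T \<omega> t * (N - N1 n T1 T \<omega> t) / (N\<^sup>2 * (N - 1))"
    by (simp add: Vk_def Ntot_eq N0 Dtot_eq tvals_nonneg[OF t] defs)
  show ?thesis
    unfolding defs[symmetric]
  proof (cases "D = 0")
    case True
    then show "\<bar>Vk n T1 T \<omega> t - e * (1 - e) * D\<bar> \<le> D * (\<bar>S\<bar> * inverse N) + dtilde n T * (D * inverse N)"
      by (simp add: V)
  next
    case False
    then have D1: "1 \<le> D"
      using D by (auto elim!: Ints_cases)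
    then have N: "1 \<le> N"
      using D by simp
    have x: "0 \<le> x" "x \<le> 1" "N1 n T1 T \<omega> t = x * N"
      using N N1_bounds by (auto simp: x_def)
    have xe: "\<bar>x - e\<bar> = \<bar>S\<bar> * inverse N"
      using N by (simp add: x_def N1_eq_score_sum defs[symmetric] field_simps abs_mult)
    have "x * (1 - x) - e * (1 - e) = (x - e) * (1 - x - e)"
      by (simp add: algebra_simps)
    then have "\<bar>x * (1 - x) - e * (1 - e)\<bar> = \<bar>x - e\<bar> * \<bar>1 - x - e\<bar>"
      by (simp add: abs_mult)
    also have "\<dots> \<le> \<bar>x - e\<bar> * 1"
      using x e by (intro mult_left_mono) auto
    finally have 1: "D * \<bar>x * (1 - x) - e * (1 - e)\<bar> \<le> D * (\<bar>S\<bar> * inverse N)"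
      using D xe by (intro mult_left_mono) auto
    have 2: "\<bar>Vk n T1 T \<omega> t - D * (x * (1 - x))\<bar> \<le> dtilde n T * (D * inverse N)"
    proof (cases "N = 1")
      case True \<comment> \<open>the denominator of \<open>Vk\<close> vanishes, so \<open>Vk\<close> is \<open>0\<close>\<close>
      have "N1 n T1 T \<omega> t \<in> \<int>"
        by (simp add: N1_def)
      then have "x = 0 \<or> x = 1"
        using True x by (auto elim!: Ints_cases)
      then show ?thesis
        using True D dtilde_nonneg by (auto simp: V)
    next
      case False
      then have N2: "1 < N"
        using N by simp
      have aux: "D * y * (1 - f) - D * y = - (D * (y * f))" for y f :: real
        by (simp add: algebra_simps)
      have "Vk n T1 T \<omega> t = D * (x * (1 - x)) * ((N - D) / (N - 1))"
        unfolding V x(3) using N2 by (simp add: power2_eq_square field_simps)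
      also have "(N - D) / (N - 1) = 1 - (D - 1) / (N - 1)"
        using N2 by (simp add: field_simps)
      finally have "Vk n T1 T \<omega> t - D * (x * (1 - x)) = - (D * ((x * (1 - x)) * ((D - 1) / (N - 1))))"
        by (rule ssubst) (rule aux)
      moreover have "0 \<le> D * ((x * (1 - x)) * ((D - 1) / (N - 1)))"
        using D D1 N2 x by simp
      ultimately have "\<bar>Vk n T1 T \<omega> t - D * (x * (1 - x))\<bar> = D * ((x * (1 - x)) * ((D - 1) / (N - 1)))"
        by linarith
      also have "\<dots> \<le> D * (1 * (D / N))"
      proof (intro mult_left_mono mult_mono)
        show "x * (1 - x) \<le> 1"
          using x mult_mono[of x 1 "1 - x" 1] by simp
        have "D / N \<le> 1"
          using D N2 by simp
        then have "D - 1 \<le> D / N * (N - 1)"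
          using N2 by (simp add: right_diff_distrib)
        then show "(D - 1) / (N - 1) \<le> D / N"
          using N2 by (intro mult_imp_div_pos_le) auto
      qed (use D D1 N2 x in auto)
      also have "\<dots> \<le> dtilde n T * (D * inverse N)"
        using mult_right_mono[OF D(3), of "D * inverse N"] D N2 by (simp add: divide_inverse)
      finally show ?thesis .
    qed
    have "Vk n T1 T \<omega> t - e * (1 - e) * D
        = (Vk n T1 T \<omega> t - D * (x * (1 - x))) + D * (x * (1 - x) - e * (1 - e))"
      by (simp add: algebra_simps)
    then have "\<bar>Vk n T1 T \<omega> t - e * (1 - e) * D\<bar>
        \<le> \<bar>Vk n T1 T \<omega> t - D * (x * (1 - x))\<bar> + D * \<bar>x * (1 - x) - e * (1 - e)\<bar>"
      using D abs_triangle_ineq[of "Vk n T1 T \<omega> t - D * (x * (1 - x))" "D * (x * (1 - x) - e * (1 - e))"]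
      by (simp add: abs_mult)
    with 1 2 show "\<bar>Vk n T1 T \<omega> t - e * (1 - e) * D\<bar> \<le> D * (\<bar>S\<bar> * inverse N) + dtilde n T * (D * inverse N)"
      by linarith
  qed
qed

lemma bdd_rv_Ustat: "bdd_rv (Ustat n T1 T)"
proof -
  have N1: "bdd_rv (\<lambda>\<omega>. N1 n T1 T \<omega> t)" for t
    unfolding N1_eq by (intro bdd_rv_sum bdd_rv_mult bdd_rv_at_risk bdd_rv_treated risk_setD)
  have N0: "bdd_rv (\<lambda>\<omega>. N0 n T1 T \<omega> t)" for t
  proof -
    have "N0 n T1 T \<omega> t = risk_count t \<omega> - N1 n T1 T \<omega> t" for \<omega>
      using Ntot_eq[of \<omega> t] by (simp add: Ntot_def)
    then show ?thesis
      using N1[of t] by auto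
  qed
  have "bdd_rv (\<lambda>\<omega>. event_count t \<omega> * (risk_count t \<omega> - event_count t \<omega>) * N1 n T1 T \<omega> t * N0 n T1 T \<omega> t
      * inverse ((risk_count t \<omega>)\<^sup>2 * (risk_count t \<omega> - 1)))" for t
    by (intro bdd_rv_mult N1 N0 bdd_rv_inverse_Ints bdd_rv_diff bdd_rv_power2 bdd_rv_risk_count
        bdd_rv_event_count bdd_rv_const Ints_mult Ints_diff Ints_power risk_count_Ints Ints_1)
  then have "bdd_rv (\<lambda>\<omega>. \<Sum>t\<in>tvals n T. event_count t \<omega> * (risk_count t \<omega> - event_count t \<omega>)
      * N1 n T1 T \<omega> t * N0 n T1 T \<omega> t * inverse ((risk_count t \<omega>)\<^sup>2 * (risk_count t \<omega> - 1)))"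
    by (rule bdd_rv_sum)
  also have "(\<lambda>\<omega>. \<Sum>t\<in>tvals n T. event_count t \<omega> * (risk_count t \<omega> - event_count t \<omega>)
      * N1 n T1 T \<omega> t * N0 n T1 T \<omega> t * inverse ((risk_count t \<omega>)\<^sup>2 * (risk_count t \<omega> - 1))) = Ustat n T1 T"
    unfolding Ustat_def
    by (intro ext sum.cong refl) (simp add: Vk_def Ntot_eq Dtot_eq tvals_nonneg divide_inverse)
  finally show ?thesis .
qed

definition linear_Ustat :: "outcome \<Rightarrow> real" where
  "linear_Ustat \<omega> = (\<Sum>t\<in>tvals n T. treat_prob t * (1 - treat_prob t) * event_count t \<omega>)"

lemma bdd_rv_linear_Ustat: "bdd_rv linear_Ustat"
  unfolding linear_Ustat_def by (intro bdd_rv_sum bdd_rv_mult bdd_rv_const bdd_rv_event_count)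

lemma expectation_linear_Ustat_diff_le:
  "P.expectation (\<lambda>\<omega>. \<bar>linear_Ustat \<omega> - total_var\<bar>) \<le> sqrt total_var"
proof -
  define q where "q t = treat_prob t * (1 - treat_prob t)" for t
  have q: "0 \<le> q t" "q t \<le> 1" "risk_prob t * q t = score_var t" for t
    using treat_prob_nonneg treat_prob_le_1 treat_prob_variance_le by (auto simp: q_def score_var_def)
  define g where "g i w = q (T i) * at_risk (T i) w - score_var (T i)" for i w
  have [measurable]: "g i \<in> borel_measurable unit_law" for i
    unfolding g_def by measurable
  have int: "integrable unit_law (at_risk t)" for t
    by (rule unit_law.integrable_const_bound[where B=1]) (auto simp: at_risk_def)
  have g_bound: "\<bar>g i w\<bar> \<le> 1" for i w
    using q[of "T i"] at_risk_cases[of "T i" w] score_var_nonneg[of "T i"] score_var_le_1[of "T i"]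
    by (auto simp: g_def)
  have mean: "integral\<^sup>L unit_law (g i) = 0" for i
    unfolding g_def using int q(3)[of "T i"] unit_law.prob_space by (simp add: integral_at_risk mult.commute)
  have var: "(\<integral>w. (g i w)\<^sup>2 \<partial>unit_law) \<le> score_var (T i)" for i
  proof -
    let ?q = "q (T i)" and ?v = "score_var (T i)"
    have "(g i w)\<^sup>2 = (?q\<^sup>2 - 2 * ?q * ?v) * at_risk (T i) w + ?v\<^sup>2" for w
      using at_risk_cases[of "T i" w] by (auto simp: g_def power2_eq_square algebra_simps)
    then have "(\<integral>w. (g i w)\<^sup>2 \<partial>unit_law) = (?q\<^sup>2 - 2 * ?q * ?v) * risk_prob (T i) + ?v\<^sup>2"
      using int unit_law.prob_space by (simp add: integral_at_risk)
    also have "\<dots> = ?q * (risk_prob (T i) * ?q) - 2 * (risk_prob (T i) * ?q) * ?v + ?v\<^sup>2"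
      by (simp add: power2_eq_square algebra_simps)
    also have "\<dots> = ?q * ?v - ?v * ?v"
      unfolding q(3) by (simp add: power2_eq_square)
    also have "\<dots> \<le> 1 * ?v"
      using mult_right_mono[OF q(2)[of "T i"] score_var_nonneg[of "T i"]]
        zero_le_square[of ?v] by linarith
    finally show ?thesis by simp
  qed
  have "linear_Ustat \<omega> - total_var = (\<Sum>i<n. g i (\<omega> i))" for \<omega>
    unfolding linear_Ustat_def total_var_eq event_count_def q_def[symmetric] sum_distrib_left
    using sum_over_tvals[of "\<lambda>t i. q t * at_risk t (\<omega> i)"] by (simp add: g_def sum_subtractf)
  then have eq: "P.expectation (\<lambda>\<omega>. (linear_Ustat \<omega> - total_var)\<^sup>2) = (\<Sum>i<n. \<integral>w. (g i w)\<^sup>2 \<partial>unit_law)"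
    using expectation_sum_centered_sq[of "{..<n}" g "\<lambda>_. 1"] mean g_bound by simp
  have "P.expectation (\<lambda>\<omega>. \<bar>linear_Ustat \<omega> - total_var\<bar>) \<le> sqrt (P.expectation (\<lambda>\<omega>. (linear_Ustat \<omega> - total_var)\<^sup>2))"
    by (intro expectation_abs_le_sqrt bdd_rv_diff bdd_rv_linear_Ustat bdd_rv_const)
  also have "\<dots> \<le> sqrt total_var"
    unfolding eq by (subst total_var_eq) (intro real_sqrt_le_mono sum_mono var)
  finally show ?thesis .
qed

lemma expectation_Ustat_diff_le:
  "P.expectation (\<lambda>\<omega>. \<bar>Ustat n T1 T \<omega> - total_var\<bar>)
    \<le> sqrt total_var + sqrt total_hazard * sqrt total_var + dtilde n T * total_hazard"
proof -
  define a where "a t \<omega> = event_count t \<omega> * (\<bar>score_sum t \<omega>\<bar> * inverse (risk_count t \<omega>))" for t \<omega>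
  define b where "b t \<omega> = event_count t \<omega> * inverse (risk_count t \<omega>)" for t \<omega>
  have bdd_a: "bdd_rv (a t)" for t
    unfolding a_def by (intro bdd_rv_mult bdd_rv_abs bdd_rv_event_count bdd_rv_score_sum bdd_rv_inverse_risk_count)
  have bdd_b: "bdd_rv (b t)" for t
    unfolding b_def by (intro bdd_rv_mult bdd_rv_event_count bdd_rv_inverse_risk_count)
  note bdd = bdd_a bdd_b bdd_rv_linear_Ustat bdd_rv_Ustat
  have pointwise: "\<bar>Ustat n T1 T \<omega> - total_var\<bar>
      \<le> \<bar>linear_Ustat \<omega> - total_var\<bar> + ((\<Sum>t\<in>tvals n T. a t \<omega>) + dtilde n T * (\<Sum>t\<in>tvals n T. b t \<omega>))" for \<omega>
  proof -
    have "\<bar>Ustat n T1 T \<omega> - linear_Ustat \<omega>\<bar> \<le> (\<Sum>t\<in>tvals n T. a t \<omega> + dtilde n T * b t \<omega>)"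
      unfolding Ustat_def linear_Ustat_def sum_subtractf[symmetric] a_def b_def
      by (rule order_trans[OF sum_abs]) (intro sum_mono Vk_approx)
    then show ?thesis
      by (simp add: sum.distrib sum_distrib_left)
  qed
  have "P.expectation (\<lambda>\<omega>. \<bar>Ustat n T1 T \<omega> - total_var\<bar>)
      \<le> P.expectation (\<lambda>\<omega>. \<bar>linear_Ustat \<omega> - total_var\<bar>
          + ((\<Sum>t\<in>tvals n T. a t \<omega>) + dtilde n T * (\<Sum>t\<in>tvals n T. b t \<omega>)))"
    by (intro integral_mono pointwise bdd_rv_integrable bdd_rv_add bdd_rv_abs bdd_rv_diff bdd_rv_sum
        bdd_rv_mult bdd_rv_const bdd)
  also have "\<dots> = P.expectation (\<lambda>\<omega>. \<bar>linear_Ustat \<omega> - total_var\<bar>)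
      + ((\<Sum>t\<in>tvals n T. P.expectation (a t)) + dtilde n T * (\<Sum>t\<in>tvals n T. P.expectation (b t)))"
    by (simp add: Bochner_Integration.integral_sum bdd_rv_integrable bdd bdd_rv_abs bdd_rv_diff bdd_rv_const bdd_rv_sum
        bdd_rv_mult)
  also have "\<dots> \<le> sqrt total_var + (sqrt total_hazard * sqrt total_var + dtilde n T * total_hazard)"
  proof (intro add_mono mult_left_mono dtilde_nonneg expectation_linear_Ustat_diff_le)
    show "(\<Sum>t\<in>tvals n T. P.expectation (b t)) \<le> total_hazard"
      unfolding total_hazard_def b_def by (intro sum_mono expectation_event_risk_ratio_le)
    have "(\<Sum>t\<in>tvals n T. P.expectation (a t))
        \<le> (\<Sum>t\<in>tvals n T. sqrt (hazard t) * sqrt (real (card (event_set t)) * score_var t))"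
      unfolding a_def by (intro sum_mono expectation_event_count_score_le)
    also have "\<dots> \<le> sqrt total_hazard * sqrt total_var"
    proof -
      have "(\<Sum>t\<in>tvals n T. sqrt (hazard t) * sqrt (real (card (event_set t)) * score_var t))\<^sup>2
          \<le> (\<Sum>t\<in>tvals n T. (sqrt (hazard t))\<^sup>2) * (\<Sum>t\<in>tvals n T. (sqrt (real (card (event_set t)) * score_var t))\<^sup>2)"
        by (rule Cauchy_Schwarz_ineq_sum)
      also have "\<dots> = total_hazard * total_var"
        unfolding total_hazard_def total_var_def
        by (simp add: hazard_nonneg score_var_nonneg)
      finally show ?thesis
        unfolding real_sqrt_mult[symmetric] by (rule real_le_rsqrt)
    qed
    finally show "(\<Sum>t\<in>tvals n T. P.expectation (a t)) \<le> sqrt total_hazard * sqrt total_var" .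
  qed
  finally show ?thesis by simp
qed

definition unit_term :: "nat \<Rightarrow> bool \<times> ennreal \<times> ennreal \<Rightarrow> real" where
  "unit_term i w = (\<Sum>t\<in>tvals n T. of_bool (t \<le> T i) * (contrast t i * score t w))"

lemma linear_stat_eq: "linear_stat \<omega> = (\<Sum>i<n. unit_term i (\<omega> i))"
  unfolding linear_stat_def linear_part_def sum_risk_set unit_term_def by (rule sum.swap)

lemma unit_term_measurable [measurable]: "unit_term i \<in> borel_measurable unit_law"
  unfolding unit_term_def by measurable

lemma integral_unit_term: "integral\<^sup>L unit_law (unit_term i) = 0"
proof -
  have "integrable unit_law (score t)" for t
    by (rule unit_law.integrable_const_bound[where B=1]) (auto intro!: AE_I2 abs_score_le_1)
  then show ?thesis
    unfolding unit_term_def by (simp add: integral_score)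
qed

lemma abs_unit_term_le:
  assumes "i < n"
  shows "\<bar>unit_term i w\<bar> \<le> 1 + total_hazard"
proof -
  have "\<bar>unit_term i w\<bar> \<le> (\<Sum>t\<in>tvals n T. \<bar>of_bool (t \<le> T i) * (contrast t i * score t w)\<bar>)"
    unfolding unit_term_def by (rule sum_abs)
  also have "\<dots> \<le> (\<Sum>t\<in>tvals n T. of_bool (T i = t) + hazard t)"
  proof (rule sum_mono)
    fix t
    have "\<bar>contrast t i * score t w\<bar> \<le> \<bar>contrast t i\<bar> * 1"
      unfolding abs_mult by (intro mult_left_mono abs_score_le_1) auto
    also have "\<dots> \<le> of_bool (T i = t) + hazard t"
      using hazard_nonneg[of t] by (auto simp: contrast_def)
    finally show "\<bar>of_bool (t \<le> T i) * (contrast t i * score t w)\<bar> \<le> of_bool (T i = t) + hazard t"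
      using hazard_nonneg[of t] by (auto simp: of_bool_def)
  qed
  also have "\<dots> = (\<Sum>t\<in>tvals n T. of_bool (T i = t)) + total_hazard"
    by (simp add: sum.distrib total_hazard_def)
  also have "(\<Sum>t\<in>tvals n T. of_bool (T i = t)) = (1::real)"
    using assms by (simp add: of_bool_def tvals_def)
  finally show ?thesis .
qed

lemma indep_vars_components:
  assumes "n \<noteq> 0"
  shows "P.indep_vars (\<lambda>_. unit_law) (\<lambda>i \<omega>. \<omega> i) {..<n}"
proof -
  have "distr P (PiM {..<n} (\<lambda>_. unit_law)) (\<lambda>x. \<lambda>i\<in>{..<n}. x i) = distr P P (\<lambda>x. x)"
    unfolding P_eq_PiM
    by (rule distr_cong) (auto simp: space_PiM PiE_def extensional_restrict)
  also have "\<dots> = PiM {..<n} (\<lambda>i. distr P unit_law (\<lambda>x. x i))"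
    unfolding P_eq_PiM distr_id2[OF refl] by (rule PiM_cong[symmetric]) (auto simp: PS.PiM_component)
  finally show ?thesis
    using assms by (subst P.indep_vars_iff_distr_eq_PiM') (auto simp: P_eq_PiM)
qed

lemma char_linear_stat:
  fixes t :: real
  defines "s \<equiv> P.expectation (\<lambda>\<omega>. (linear_stat \<omega>)\<^sup>2)"
  assumes "0 < s"
  shows "cmod (char (distr P borel (\<lambda>\<omega>. linear_stat \<omega> / sqrt s)) t - exp (- t\<^sup>2 / 2))
    \<le> \<bar>t\<bar> ^ 3 * ((1 + total_hazard) / sqrt s) / 6 + t ^ 4 * ((1 + total_hazard) / sqrt s)\<^sup>2 / 8"
proof -
  let ?X = "\<lambda>i \<omega>. unit_term i (\<omega> i) / sqrt s"
  define b where "b = (1 + total_hazard) / sqrt s"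
  have indep: "P.indep_vars (\<lambda>_. borel) (\<lambda>i \<omega>. unit_term i (\<omega> i) / sqrt s) {..<n}"
  proof (rule P.indep_vars_compose2[OF indep_vars_components])
    show "n \<noteq> 0"
    proof
      assume "n = 0"
      then have "linear_stat \<omega> = 0" for \<omega>
        unfolding linear_stat_eq by simp
      then show False
        using \<open>0 < s\<close> by (simp add: s_def)
    qed
  qed auto
  have s_eq: "s = (\<Sum>i<n. \<integral>w. (unit_term i w)\<^sup>2 \<partial>unit_law)"
    unfolding s_def linear_stat_eq
    by (rule expectation_sum_centered_sq[where b="\<lambda>_. 1 + total_hazard"])
      (auto simp: integral_unit_term abs_unit_term_le)
  have var: "(\<Sum>i<n. P.expectation (\<lambda>\<omega>. (unit_term i (\<omega> i) / sqrt s)\<^sup>2)) = 1"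
  proof -
    have "P.expectation (\<lambda>\<omega>. (unit_term i (\<omega> i) / sqrt s)\<^sup>2) = (\<integral>w. (unit_term i w)\<^sup>2 \<partial>unit_law) / s" if "i < n" for i
      using expectation_component[OF that, of "\<lambda>w. (unit_term i w / sqrt s)\<^sup>2"] \<open>0 < s\<close>
      by (simp add: power_divide)
    then have "(\<Sum>i<n. P.expectation (\<lambda>\<omega>. (unit_term i (\<omega> i) / sqrt s)\<^sup>2)) = s / s"
      by (subst (2) s_eq) (simp add: sum_divide_distrib)
    then show ?thesis
      using \<open>0 < s\<close> by simp
  qed
  have mean: "P.expectation (\<lambda>\<omega>. unit_term i (\<omega> i) / sqrt s) = 0" if "i \<in> {..<n}" for i
    using expectation_component[of i "\<lambda>w. unit_term i w / sqrt s"] that by (simp add: integral_unit_term)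
  have bound: "\<bar>unit_term i (\<omega> i) / sqrt s\<bar> \<le> b" if "i \<in> {..<n}" for i \<omega>
    unfolding b_def using abs_unit_term_le[of i "\<omega> i"] that \<open>0 < s\<close> by (simp add: abs_divide divide_right_mono)
  show ?thesis
    unfolding linear_stat_eq sum_divide_distrib b_def[symmetric]
    by (rule P.char_sum_indep_bounded[where X="?X"]) (rule indep var | erule mean bound)+
qed

end

section \<open>The logrank test\<close>

theorem theorem4:
  fixes p1 :: "nat \<Rightarrow> real"
    and Q :: "nat \<Rightarrow> (ennreal \<times> ennreal) measure"
    and T1 T0 :: "nat \<Rightarrow> nat \<Rightarrow> real"
  assumes H0: "\<And>n i. i < n \<Longrightarrow> T1 n i = T0 n i"
    and Tnonneg: "\<And>n i. i < n \<Longrightarrow> T0 n i \<ge> 0 \<and> T1 n i \<ge> 0"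
    and p_range: "\<And>n. 0 < p1 n \<and> p1 n < 1"
    and Q_prob: "\<And>n. prob_space (Q n)"
    and Q_sets: "\<And>n. sets (Q n) = sets (borel :: (ennreal \<times> ennreal) measure)"
    and cond1_i: "\<exists>a. 0 < a \<and> a < 1 \<and> p1 \<longlonglongrightarrow> a"
    and cond1_ii: "filterlim (\<lambda>n. min ((gtilde n (T0 n) (Q n) / dtilde n (T0 n)) * sqrt (real n / ln (real n)))
                                   (gtilde n (T0 n) (Q n) * real n / (dtilde n (T0 n)) ^ 3))
                     at_top sequentially"
  shows "(\<forall>e>0. (\<lambda>n. measure (pop_measure n (p1 n) (Q n))
              {om \<in> space (pop_measure n (p1 n) (Q n)).
                 \<bar>Ustat n (T1 n) (T0 n) om / pvariance (pop_measure n (p1 n) (Q n)) (Lstat n (T1 n) (T0 n)) - 1\<bar> > e})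
            \<longlonglongrightarrow> 0)
         \<and> weak_conv_m (\<lambda>n. distr (pop_measure n (p1 n) (Q n)) borel (LRstat n (T1 n) (T0 n)))
           std_normal_distribution"
proof -
  have pop: "logrank_population n (T1 n) (T0 n) (p1 n) (Q n)" for n
    by (rule logrank_population.intro) (use H0 Tnonneg p_range Q_prob Q_sets in simp_all)
  define M where "M n = pop_measure n (p1 n) (Q n)" for n
  define L where "L n = Lstat n (T1 n) (T0 n)" for n
  define U where "U n = Ustat n (T1 n) (T0 n)" for n
  define X where "X n = logrank_population.linear_stat n (T0 n) (p1 n) (Q n)" for n
  define v where "v n = logrank_population.total_var n (T0 n) (p1 n) (Q n)" for n
  define h where "h n = logrank_population.total_hazard n (T0 n)" for n
  define d where "d n = dtilde n (T0 n)" for n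
  define s where "s n = (\<integral>x. (X n x)\<^sup>2 \<partial>M n)" for n
  note defs = M_def L_def U_def X_def v_def h_def d_def
  have P_eq: "logrank_population.P n (p1 n) (Q n) = M n" for n
    by (simp add: logrank_population.P_def[OF pop] M_def)
  note unfold = P_eq defs[symmetric]
  have M: "prob_space (M n)" for n
  proof -
    interpret logrank_population n "T1 n" "T0 n" "p1 n" "Q n" by (rule pop)
    show ?thesis
      using P.prob_space_axioms by (simp add: P_eq)
  qed
  have bdd: "logrank_population.bdd_rv n (p1 n) (Q n) (L n)" "logrank_population.bdd_rv n (p1 n) (Q n) (X n)"
    "logrank_population.bdd_rv n (p1 n) (Q n) (U n)" for n
    unfolding defs
    by (rule logrank_population.bdd_rv_Lstat[OF pop] logrank_population.bdd_rv_linear_stat[OF pop]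
        logrank_population.bdd_rv_Ustat[OF pop])+
  note bdd_int = logrank_population.bdd_rv_integrable[OF pop, unfolded P_eq]
  note bdd_meas = logrank_population.bdd_rv_measurable[OF pop, unfolded P_eq]
  have h_nonneg: "0 \<le> h n" and h_harm: "h n \<le> harm n"
    and diff_le: "(\<integral>x. (L n x - X n x)\<^sup>2 \<partial>M n) \<le> h n"
    and s_le: "s n \<le> v n" and s_ge: "v n - d n * h n \<le> s n"
    and U_le: "(\<integral>x. \<bar>U n x - v n\<bar> \<partial>M n) \<le> sqrt (v n) + sqrt (h n) * sqrt (v n) + d n * h n"
    and v_ge: "p1 n * (1 - p1 n) * (real n * gtilde n (T0 n) (Q n)) \<le> v n"
    and var_eq: "pvariance (M n) (L n) = (\<integral>x. (L n x)\<^sup>2 \<partial>M n)" for n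
    using logrank_population.total_hazard_nonneg[OF pop, of n]
      logrank_population.total_hazard_le_harm[OF pop, of n] logrank_population.expectation_Lstat_diff_sq_le[OF pop, of n]
      logrank_population.expectation_linear_stat_sq_le[OF pop, of n]
      logrank_population.expectation_linear_stat_sq_ge[OF pop, of n]
      logrank_population.expectation_Ustat_diff_le[OF pop, of n] logrank_population.total_var_ge[OF pop, of n]
      logrank_population.pvariance_Lstat[OF pop, of n]
    by (simp_all add: unfold s_def)
  define r where "r n = sqrt (real n * ln (real n))" for n
  define H where "H n = 1 + ln (real n)" for n
  obtain a where a: "0 < a" "a < 1" "p1 \<longlonglongrightarrow> a"
    using cond1_i by blast
  define c where "c = a * (1 - a) / 2"
  have c: "0 < c"
    using a by (simp add: c_def)
  have "(\<lambda>n. p1 n * (1 - p1 n)) \<longlonglongrightarrow> a * (1 - a)"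
    by (intro tendsto_intros a)
  then have p_ev: "eventually (\<lambda>n. c < p1 n * (1 - p1 n)) sequentially"
    by (rule order_tendstoD(1)) (use a in \<open>simp add: c_def\<close>)
  have rate_ev: "eventually (\<lambda>n. 1 / c \<le> min ((gtilde n (T0 n) (Q n) / d n) * sqrt (real n / ln (real n)))
      (gtilde n (T0 n) (Q n) * real n / d n ^ 3)) sequentially"
    using cond1_ii unfolding filterlim_at_top d_def by blast
  have main: "eventually (\<lambda>n. 0 < r n \<and> 0 \<le> H n \<and> h n \<le> H n \<and> 1 \<le> d n \<and> d n * r n \<le> v n) sequentially"
    using p_ev rate_ev eventually_ge_at_top[of 2]
  proof eventually_elim
    case (elim n)
    let ?g = "gtilde n (T0 n) (Q n)"
    have ln_pos: "0 < ln (real n)"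
      using elim by simp
    then have r: "0 < r n"
      using elim by (simp add: r_def)
    have rate: "1 / c \<le> ?g / d n * sqrt (real n / ln (real n))"
      using elim by simp
    then have "d n \<noteq> 0"
      using c by auto
    then have d: "1 \<le> d n"
      by (simp add: d_def dtilde_def)
    have "sqrt (real n / ln (real n)) * r n = real n"
      unfolding r_def real_sqrt_mult[symmetric] using ln_pos by (simp add: real_sqrt_mult)
    then have "d n * r n * (?g / d n * sqrt (real n / ln (real n))) = real n * ?g"
      using d by (simp add: field_simps)
    moreover have "d n * r n * (1 / c) \<le> d n * r n * (?g / d n * sqrt (real n / ln (real n)))"
      using rate d r by (intro mult_left_mono) auto
    ultimately have "d n * r n / c \<le> real n * ?g"
      by simp
    then have "d n * r n \<le> c * (real n * ?g)"
      using c by (simp add: field_simps)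
    also have "\<dots> \<le> p1 n * (1 - p1 n) * (real n * ?g)"
    proof (rule mult_right_mono)
      have "0 \<le> d n * r n / c"
        using d r c by simp
      then show "0 \<le> real n * ?g"
        using \<open>d n * r n / c \<le> real n * ?g\<close> by linarith
    qed (use elim in simp)
    also have "\<dots> \<le> v n"
      by (rule v_ge)
    finally have "d n * r n \<le> v n" .
    moreover have "h n \<le> H n"
      using h_harm[of n] euler_mascheroni_sequence_decreasing[of 1 n] elim by (simp add: H_def harm_def)
    ultimately show ?case
      using r d ln_pos by (simp add: H_def)
  qed
  have H_lim: "(\<lambda>n. H n / r n) \<longlonglongrightarrow> 0" and r_lim: "(\<lambda>n. 1 / r n) \<longlonglongrightarrow> 0"
    and H2_lim: "(\<lambda>n. 2 * (1 + H n)\<^sup>2 / r n) \<longlonglongrightarrow> 0"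
    unfolding H_def r_def by real_asymp+
  have bounds: "eventually (\<lambda>n. 0 < v n \<and> h n / v n \<le> H n / r n \<and> d n * h n / v n \<le> H n / r n
      \<and> 1 / v n \<le> 1 / r n) sequentially"
    using main
  proof eventually_elim
    case (elim n)
    have "1 * r n \<le> d n * r n"
      using elim by (intro mult_right_mono) auto
    then have rv: "r n \<le> v n"
      using elim by linarith
    have "h n / v n \<le> H n / r n"
      using elim rv h_nonneg[of n] by (intro frac_le) auto
    moreover have "d n * h n / v n \<le> d n * H n / (d n * r n)"
      using elim rv h_nonneg[of n] by (intro frac_le mult_left_mono) auto
    moreover have "1 / v n \<le> 1 / r n"
      using elim rv by (intro frac_le) auto
    ultimately show ?case
      using elim rv by simp
  qed
  have v_pos: "eventually (\<lambda>n. 0 < v n) sequentially"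
    using bounds by eventually_elim simp
  have diff_lim: "(\<lambda>n. (\<integral>x. (L n x - X n x)\<^sup>2 \<partial>M n) / v n) \<longlonglongrightarrow> 0"
  proof (rule Lim_null_comparison[OF _ H_lim])
    show "\<forall>\<^sub>F n in sequentially. norm ((\<integral>x. (L n x - X n x)\<^sup>2 \<partial>M n) / v n) \<le> H n / r n"
      using bounds
    proof eventually_elim
      case (elim n)
      have "norm ((\<integral>x. (L n x - X n x)\<^sup>2 \<partial>M n) / v n) \<le> h n / v n"
        using diff_le[of n] elim by (simp add: divide_right_mono)
      with elim show ?case by linarith
    qed
  qed
  have s_lim: "(\<lambda>n. s n / v n) \<longlonglongrightarrow> 1"
  proof (rule tendsto_sandwich)
    show "(\<lambda>n. 1 - H n / r n) \<longlonglongrightarrow> 1"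
      using tendsto_diff[OF tendsto_const H_lim, of 1] by simp
    show "\<forall>\<^sub>F n in sequentially. 1 - H n / r n \<le> s n / v n"
      using bounds
    proof eventually_elim
      case (elim n)
      have "1 - d n * h n / v n = (v n - d n * h n) / v n"
        using elim by (simp add: diff_divide_distrib)
      also have "\<dots> \<le> s n / v n"
        using s_ge[of n] elim by (intro divide_right_mono) auto
      finally show ?case
        using elim by linarith
    qed
    show "\<forall>\<^sub>F n in sequentially. s n / v n \<le> 1"
      using bounds by eventually_elim (use s_le in simp)
  qed auto
  have U_lim: "(\<lambda>n. (\<integral>x. \<bar>U n x - v n\<bar> \<partial>M n) / v n) \<longlonglongrightarrow> 0"
  proof (rule Lim_null_comparison)
    show "(\<lambda>n. sqrt (1 / r n) + sqrt (H n / r n) + H n / r n) \<longlonglongrightarrow> 0"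
      using tendsto_add[OF tendsto_add[OF tendsto_real_sqrt[OF r_lim] tendsto_real_sqrt[OF H_lim]] H_lim] by simp
    show "\<forall>\<^sub>F n in sequentially. norm ((\<integral>x. \<bar>U n x - v n\<bar> \<partial>M n) / v n) \<le> sqrt (1 / r n) + sqrt (H n / r n) + H n / r n"
      using bounds
    proof eventually_elim
      case (elim n)
      have sq: "sqrt (v n) / v n = sqrt (1 / v n)"
        using elim by (simp add: real_sqrt_divide real_div_sqrt field_simps)
      have "norm ((\<integral>x. \<bar>U n x - v n\<bar> \<partial>M n) / v n) = (\<integral>x. \<bar>U n x - v n\<bar> \<partial>M n) / v n"
        using elim by simp
      also have "\<dots> \<le> (sqrt (v n) + sqrt (h n) * sqrt (v n) + d n * h n) / v n"
        using U_le[of n] elim by (intro divide_right_mono) auto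
      also have "\<dots> = sqrt (v n) / v n + sqrt (h n) * (sqrt (v n) / v n) + d n * h n / v n"
        by (simp add: add_divide_distrib)
      also have "\<dots> = sqrt (1 / v n) + sqrt (h n / v n) + d n * h n / v n"
        unfolding sq by (simp add: real_sqrt_divide)
      also have "\<dots> \<le> sqrt (1 / r n) + sqrt (H n / r n) + H n / r n"
        using elim by (intro add_mono real_sqrt_le_mono) auto
      finally show ?case .
    qed
  qed
  have clt: "(\<lambda>n. char (distr (M n) borel (\<lambda>x. X n x / sqrt (s n))) t) \<longlonglongrightarrow> exp (- t\<^sup>2 / 2)" for t
  proof -
    define b where "b n = (1 + h n) / sqrt (s n)" for n
    have s_ev: "eventually (\<lambda>n. 1 / 2 < s n / v n) sequentially"
      by (rule order_tendstoD(1)[OF s_lim]) simp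
    have b_lim: "b \<longlonglongrightarrow> 0"
    proof (rule Lim_null_comparison)
      show "(\<lambda>n. sqrt (2 * (1 + H n)\<^sup>2 / r n)) \<longlonglongrightarrow> 0"
        using tendsto_real_sqrt[OF H2_lim] by simp
      show "\<forall>\<^sub>F n in sequentially. norm (b n) \<le> sqrt (2 * (1 + H n)\<^sup>2 / r n)"
        using main bounds s_ev
      proof eventually_elim
        case (elim n)
        have s: "v n / 2 < s n"
          using elim by (simp add: pos_less_divide_eq)
        have "(b n)\<^sup>2 = (1 + h n)\<^sup>2 * (1 / s n)"
          using s elim by (simp add: b_def power_divide)
        also have "\<dots> \<le> (1 + H n)\<^sup>2 * (2 * (1 / v n))"
        proof (intro mult_mono power_mono)
          have "1 / s n \<le> 1 / (v n / 2)"
            using s elim by (intro frac_le) auto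
          then show "1 / s n \<le> 2 * (1 / v n)"
            by simp
        qed (use h_nonneg[of n] elim s in auto)
        also have "\<dots> \<le> (1 + H n)\<^sup>2 * (2 * (1 / r n))"
          using elim by (intro mult_left_mono) auto
        finally show ?case
          by (intro real_le_rsqrt) (simp add: mult_ac)
      qed
    qed
    have "(\<lambda>n. \<bar>t\<bar> ^ 3 * b n / 6 + t ^ 4 * (b n)\<^sup>2 / 8) \<longlonglongrightarrow> \<bar>t\<bar> ^ 3 * 0 / 6 + t ^ 4 * 0\<^sup>2 / 8"
      by (intro tendsto_intros b_lim) auto
    then have lim: "(\<lambda>n. \<bar>t\<bar> ^ 3 * b n / 6 + t ^ 4 * (b n)\<^sup>2 / 8) \<longlonglongrightarrow> 0"
      by simp
    have "(\<lambda>n. char (distr (M n) borel (\<lambda>x. X n x / sqrt (s n))) t - exp (- t\<^sup>2 / 2)) \<longlonglongrightarrow> 0"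
    proof (rule Lim_null_comparison[OF _ lim])
      show "\<forall>\<^sub>F n in sequentially. norm (char (distr (M n) borel (\<lambda>x. X n x / sqrt (s n))) t - exp (- t\<^sup>2 / 2))
          \<le> \<bar>t\<bar> ^ 3 * b n / 6 + t ^ 4 * (b n)\<^sup>2 / 8"
        using bounds s_ev
      proof eventually_elim
        case (elim n)
        have "v n / 2 < s n"
          using elim by (simp add: pos_less_divide_eq)
        then have "0 < s n"
          using elim by linarith
        then show ?case
          using logrank_population.char_linear_stat[OF pop, of n t]
          by (simp only: unfold s_def[symmetric] b_def)
      qed
    qed
    then show ?thesis
      by (rule LIM_zero_cancel)
  qed
  have int: "integrable (M n) (\<lambda>x. (L n x)\<^sup>2)" "integrable (M n) (\<lambda>x. (X n x)\<^sup>2)"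
    "integrable (M n) (\<lambda>x. (L n x - X n x)\<^sup>2)" "integrable (M n) (U n)" for n
    by (rule bdd_int logrank_population.bdd_rv_power2[OF pop] logrank_population.bdd_rv_diff[OF pop] bdd)+
  note conv = studentized_convergence[of M L X U v, OF M bdd_meas[OF bdd(1)] bdd_meas[OF bdd(2)] bdd_meas[OF bdd(3)]
      int v_pos diff_lim s_lim[unfolded s_def] U_lim clt[unfolded s_def]]
  have LR: "LRstat n (T1 n) (T0 n) = (\<lambda>x. L n x / sqrt (U n x))" for n
    by (simp add: LRstat_def L_def U_def fun_eq_iff)
  show ?thesis
    unfolding LR M_def[symmetric] U_def[symmetric] L_def[symmetric] var_eq
    using conv by blast
qed

end
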